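(* Let $d\ge 1$ and $\nu\ge 2$ be integers, let $\lambda>0$, let $\Lambda\subset\mathbb{Z}^d$ be a finite index set with $\mathbf 0\in\Lambda$ and $\Lambda=-\Lambda$, put $\Lambda_0=\Lambda\setminus\{\mathbf 0\}$, and let $\mathbf c=\{c_{\mathbf k}\}_{\mathbf k\in\Lambda}$ and $\mathbf m=\{m_{\mathbf k}\}_{\mathbf k\in\Lambda_0}$ be real multisequences with $c_{-\mathbf k}=c_{\mathbf k}$ and $m_{-\mathbf k}=m_{\mathbf k}$. Assume (feasibility) that there is a nonnegative function $\Phi_0$ on $\mathbb{T}^d$, positive on some open ball $B_1\subset\mathbb{T}^d$, such that $$c_{\mathbf k}=\int_{\mathbb{T}^d}e^{i\langle \mathbf k,\boldsymbol\theta\rangle}\,\Phi_0\,\mathrm d\mu\qquad\forall\,\mathbf k\in\Lambda .$$ Assume moreover that $\nu\ge d/2$. Then the optimization problem $$\min\ J_{\nu,\lambda}(P,Q)\quad\text{s.t. } P\in\overline{\mathfrak P}_{+,o},\ Q\in\overline{\mathfrak P}_{+}$$ admits a unique interior-point solution $(\hat P,\hat Q)\in\mathfrak P_{+,o}\times\mathfrak P_{+}$, and this solution is such that $$c_{\mathbf k}=\int_{\mathbb{T}^d}e^{i\langle\mathbf k,\boldsymbol\theta\rangle}\Big(\frac{\hat P}{\hat Q}\Big)^{\nu}\mathrm d\mu\qquad\forall\,\mathbf k\in\Lambda,$$ $$m_{\mathbf k}=\int_{\mathbb{T}^d}e^{i\langle\mathbf k,\boldsymbol\theta\rangle}\,\frac{\nu}{\nu-1}\left[\Big(\frac{\hat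 P}{\hat Q}\Big)^{\nu-1}-\frac{\lambda}{\hat P^{\nu+1}}\right]\mathrm d\mu\qquad\forall\,\mathbf k\in\Lambda_0 .$$ In other words, the spectral density $\hat\Phi_\nu=(\hat P/\hat Q)^\nu$ matches the covariances $c_{\mathbf k}$, $\mathbf k\in\Lambda$, exactly, and matches the $\nu$-cepstral coefficients $m_{\mathbf k}$ approximately, in the sense that for every $\mathbf k\in\Lambda_0$ $$\frac{\nu}{\nu-1}\int_{\mathbb{T}^d}e^{i\langle\mathbf k,\boldsymbol\theta\rangle}\hat\Phi_\nu^{\frac{\nu-1}{\nu}}\mathrm d\mu-m_{\mathbf k}=\varepsilon_{\mathbf k},\qquad \varepsilon_{\mathbf k}=\frac{\lambda\nu}{\nu-1}\int_{\mathbb{T}^d}e^{i\langle\mathbf k,\boldsymbol\theta\rangle}\frac{1}{\hat P^{\nu+1}}\,\mathrm d\mu .$$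
   Context: $\mathbb{T}^d=(0,2\pi]^d$ is identified with the $d$-torus via $\boldsymbol\theta=(\theta_1,\dots,\theta_d)\mapsto e^{i\boldsymbol\theta}=(e^{i\theta_1},\dots,e^{i\theta_d})$; $\mathrm d\mu=\frac{1}{(2\pi)^d}\prod_{j=1}^d\mathrm d\theta_j$ is the normalized Lebesgue measure; $\langle\mathbf k,\boldsymbol\theta\rangle=\sum_{j=1}^d k_j\theta_j$. Trigonometric polynomials are $Q(e^{i\boldsymbol\theta})=\sum_{\mathbf k\in\Lambda}q_{\mathbf k}e^{-i\langle\mathbf k,\boldsymbol\theta\rangle}$ with real coefficients satisfying $q_{-\mathbf k}=q_{\mathbf k}$ (hence real-valued), and likewise $P(e^{i\boldsymbol\theta})=\sum_{\mathbf k\in\Lambda}p_{\mathbf k}e^{-i\langle\mathbf k,\boldsymbol\theta\rangle}$ with $p_{-\mathbf k}=p_{\mathbf k}$; they are identified with their coefficient multisequences in a finite-dimensional real vector space. Feasible sets: $\mathfrak P_+=\{Q: Q>0\text{ on }\mathbb{T}^d\}$ and $\mathfrak P_{+,o}=\{P\in\mathfrak P_+: p_{\mathbf 0}=1\}$. Overlines denote closures (nonnegative polynomials, with $p_{\mathbf 0}=1$ in the second case). The regularized dual function is $$J_{\nu,\lambda}(P,Q)=\frac{1}{\nu-1}\int_{\mathbb{T}^d}\frac{P^\nu}{Q^{\nu-1}}\,\mathrm d\mu+\sum_{\mathbf k\in\Lambda}q_{\mathbf k}c_{\mathbf k}-\sum_{\mathbf k\in\Lambda_0}p_{\mathbf k}m_{\mathbf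 k}+\frac{\lambda}{\nu-1}\int_{\mathbb{T}^d}\frac{1}{P^\nu}\,\mathrm d\mu .$$ It is an extended real-valued function on $\overline{\mathfrak P}_{+,o}\times\overline{\mathfrak P}_+$: at boundary points the (measure-zero) zero sets of $P$ and $Q$ are excluded from the domain of integration, and the value $+\infty$ is allowed; for the identically zero polynomial $Q\equiv 0$ the value is understood to be $+\infty$. *)

theory Defs
  imports "HOL-Analysis.Analysis"
begin

text \<open>The dimension is the cardinality of the index type \<open>'d\<close>: multi-indices have type
  \<open>int ^ 'd\<close>, points of the torus have type \<open>real ^ 'd\<close>.\<close>

definition torus :: "(real ^ 'd) set" where
  "torus = {\<theta>. \<forall>j. 0 < \<theta> $ j \<and> \<theta> $ j \<le> 2 * pi}"

definition torus_measure :: "(real ^ 'd) measure" where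
  "torus_measure = density (lebesgue_on torus) (\<lambda>_. ennreal (1 / (2 * pi) ^ CARD('d)))"

definition pairing :: "int ^ 'd \<Rightarrow> real ^ 'd \<Rightarrow> real" where
  "pairing k \<theta> = (\<Sum>j\<in>UNIV. real_of_int (k $ j) * \<theta> $ j)"

definition moment :: "(real ^ 'd \<Rightarrow> real) \<Rightarrow> int ^ 'd \<Rightarrow> complex" where
  "moment f k = (LINT \<theta>|torus_measure. exp (\<i> * of_real (pairing k \<theta>)) * of_real (f \<theta>))"

text \<open>A trigonometric polynomial is identified with its coefficient family, extended by zero
  outside \<open>\<Lambda>\<close>. For finite \<open>\<Lambda>\<close> these families form a finite-dimensional real vector space,
  whose usual topology is the one induced by the product topology on functions; it is in this
  topology that \<open>closure\<close> is taken below.\<close>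

definition sym_coeffs :: "(int ^ 'd) set \<Rightarrow> (int ^ 'd \<Rightarrow> real) set" where
  "sym_coeffs \<Lambda> = {q. (\<forall>k. k \<notin> \<Lambda> \<longrightarrow> q k = 0) \<and> (\<forall>k. q (- k) = q k)}"

definition trig_poly :: "(int ^ 'd) set \<Rightarrow> (int ^ 'd \<Rightarrow> real) \<Rightarrow> real ^ 'd \<Rightarrow> complex" where
  "trig_poly \<Lambda> q \<theta> = (\<Sum>k\<in>\<Lambda>. of_real (q k) * exp (- (\<i> * of_real (pairing k \<theta>))))"

text \<open>On \<open>sym_coeffs \<Lambda>\<close> with \<open>\<Lambda> = -\<Lambda>\<close>, taking the real part loses nothing: see
  \<open>of_real_trig_val\<close>.\<close>

definition trig_val :: "(int ^ 'd) set \<Rightarrow> (int ^ 'd \<Rightarrow> real) \<Rightarrow> real ^ 'd \<Rightarrow> real" where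
  "trig_val \<Lambda> q \<theta> = Re (trig_poly \<Lambda> q \<theta>)"

definition pos_polys :: "(int ^ 'd) set \<Rightarrow> (int ^ 'd \<Rightarrow> real) set" where
  "pos_polys \<Lambda> = {q \<in> sym_coeffs \<Lambda>. \<forall>\<theta>\<in>torus. 0 < trig_val \<Lambda> q \<theta>}"

definition pos_polys_norm :: "(int ^ 'd) set \<Rightarrow> (int ^ 'd \<Rightarrow> real) set" where
  "pos_polys_norm \<Lambda> = {p \<in> pos_polys \<Lambda>. p 0 = 1}"

text \<open>Both integrals are nonnegative Lebesgue integrals with values in \<open>[0, \<infinity>]\<close> (the integrands
  are nonnegative on the closed feasible set), taken off the zero sets of the polynomials. As the
  coefficients of these integrals are positive and the linear terms are finite, no
  \<open>\<infinity> - \<infinity>\<close> occurs.\<close>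

definition dual_fun ::
  "nat \<Rightarrow> real \<Rightarrow> (int ^ 'd) set \<Rightarrow> (int ^ 'd \<Rightarrow> real) \<Rightarrow> (int ^ 'd \<Rightarrow> real)
    \<Rightarrow> (int ^ 'd \<Rightarrow> real) \<Rightarrow> (int ^ 'd \<Rightarrow> real) \<Rightarrow> ereal" where
  "dual_fun \<nu> lam \<Lambda> c m p q =
    (if q = (\<lambda>_. 0) then \<infinity>
     else
       ereal (1 / (real \<nu> - 1)) * enn2ereal
         (\<integral>\<^sup>+\<theta>\<in>{\<theta>. trig_val \<Lambda> p \<theta> \<noteq> 0 \<and> trig_val \<Lambda> q \<theta> \<noteq> 0}.
            ennreal (trig_val \<Lambda> p \<theta> ^ \<nu> / trig_val \<Lambda> q \<theta> ^ (\<nu> - 1)) \<partial>torus_measure)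
       + ereal (\<Sum>k\<in>\<Lambda>. q k * c k)
       - ereal (\<Sum>k\<in>\<Lambda> - {0}. p k * m k)
       + ereal (lam / (real \<nu> - 1)) * enn2ereal
         (\<integral>\<^sup>+\<theta>\<in>{\<theta>. trig_val \<Lambda> p \<theta> \<noteq> 0}.
            ennreal (1 / trig_val \<Lambda> p \<theta> ^ \<nu>) \<partial>torus_measure))"

lemma pairing_uminus: "pairing (- k) \<theta> = - pairing k \<theta>"
  by (simp add: pairing_def sum_negf)

lemma trig_val_sum: "trig_val \<Lambda> q \<theta> = (\<Sum>k\<in>\<Lambda>. q k * cos (pairing k \<theta>))"
  by (simp add: trig_val_def trig_poly_def Re_exp)

lemma of_real_trig_val:
  fixes \<Lambda> :: "(int ^ 'd) set"
  assumes "uminus ` \<Lambda> = \<Lambda>" and "q \<in> sym_coeffs \<Lambda>"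
  shows "of_real (trig_val \<Lambda> q \<theta>) = trig_poly \<Lambda> q \<theta>"
proof -
  let ?s = "\<Sum>k\<in>\<Lambda>. q k * sin (pairing k \<theta>)"
  have "?s = (\<Sum>k\<in>uminus ` \<Lambda>. q k * sin (pairing k \<theta>))"
    using assms(1) by simp
  also have "\<dots> = (\<Sum>k\<in>\<Lambda>. q (- k) * sin (pairing (- k) \<theta>))"
    by (subst sum.reindex) (auto simp: inj_on_def)
  also have "\<dots> = - ?s"
    using assms(2) by (simp add: sym_coeffs_def pairing_uminus sum_negf)
  finally have "?s = 0" by simp
  moreover have "Im (trig_poly \<Lambda> q \<theta>) = - ?s"
    by (simp add: trig_poly_def Im_exp sum_negf)
  ultimately show ?thesis
    by (simp add: complex_eq_iff trig_val_def)
qed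

lemma trig_val_add:
  "trig_val \<Lambda> (\<lambda>k. a * p k + b * q k) \<theta> = a * trig_val \<Lambda> p \<theta> + b * trig_val \<Lambda> q \<theta>"
  by (simp add: trig_val_sum sum.distrib sum_distrib_left algebra_simps)

lemma closed_coeff_conditions:
  fixes \<Lambda> :: "(int ^ 'd) set"
  shows "closed {q \<in> sym_coeffs \<Lambda>. \<forall>\<theta>\<in>torus. 0 \<le> trig_val \<Lambda> q \<theta>}"
    and "closed {q :: int ^ 'd \<Rightarrow> real. q 0 = 1}"
proof -
  have coord: "continuous_on UNIV (\<lambda>q :: int ^ 'd \<Rightarrow> real. q k)" for k
    by (rule continuous_on_product_coordinates)
  have eval: "continuous_on UNIV (\<lambda>q :: int ^ 'd \<Rightarrow> real. trig_val \<Lambda> q \<theta>)" for \<theta>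
    unfolding trig_val_sum by (intro continuous_on_sum continuous_on_mult coord continuous_on_const)
  have "{q \<in> sym_coeffs \<Lambda>. \<forall>\<theta>\<in>torus. 0 \<le> trig_val \<Lambda> q \<theta>} =
      (\<Inter>k\<in>-\<Lambda>. {q. q k = 0}) \<inter> (\<Inter>k. {q. q (- k) = q k}) \<inter>
      (\<Inter>\<theta>\<in>torus. {q. 0 \<le> trig_val \<Lambda> q \<theta>})"
    by (auto simp: sym_coeffs_def)
  also have "closed \<dots>"
    by (intro closed_Int closed_INT ballI closed_Collect_eq closed_Collect_le coord eval
        continuous_on_const)
  finally show "closed {q \<in> sym_coeffs \<Lambda>. \<forall>\<theta>\<in>torus. 0 \<le> trig_val \<Lambda> q \<theta>}" .
  show "closed {q :: int ^ 'd \<Rightarrow> real. q 0 = 1}"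
    by (intro closed_Collect_eq coord continuous_on_const)
qed

lemma const_one_poly:
  fixes \<Lambda> :: "(int ^ 'd) set"
  assumes "finite \<Lambda>" "0 \<in> \<Lambda>"
  shows "(\<lambda>k. if k = 0 then 1 else 0) \<in> sym_coeffs \<Lambda>"
    and "trig_val \<Lambda> (\<lambda>k. if k = 0 then 1 else 0) \<theta> = 1"
proof -
  show "(\<lambda>k. if k = 0 then 1 else 0) \<in> sym_coeffs \<Lambda>"
    using assms by (auto simp: sym_coeffs_def)
  have "trig_val \<Lambda> (\<lambda>k. if k = 0 then 1 else 0) \<theta> = (\<Sum>k\<in>\<Lambda>. if k = 0 then 1 else 0)"
    unfolding trig_val_sum by (rule sum.cong) (auto simp: pairing_def)
  then show "trig_val \<Lambda> (\<lambda>k. if k = 0 then 1 else 0) \<theta> = 1"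
    using assms by (simp add: sum.delta)
qed

lemma closure_perturbed:
  fixes S :: "(int ^ 'd \<Rightarrow> real) set"
  assumes "\<And>e. 0 < e \<Longrightarrow> (\<lambda>k. (q k + e * r k) / (1 + e * a)) \<in> S"
  shows "q \<in> closure S"
proof -
  define e where "e n = inverse (real (Suc n))" for n
  have e: "e \<longlonglongrightarrow> 0" "\<And>n. 0 < e n"
    using LIMSEQ_inverse_real_of_nat by (simp_all add: e_def[abs_def])
  have "(\<lambda>n. (q k + e n * r k) / (1 + e n * a)) \<longlonglongrightarrow> (q k + 0 * r k) / (1 + 0 * a)" for k
    by (intro tendsto_intros e(1)) simp
  then have lim: "(\<lambda>n k. (q k + e n * r k) / (1 + e n * a)) \<longlonglongrightarrow> q"
    using limitin_componentwise[of "\<lambda>_. euclidean" UNIV _ q sequentially]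
    by (simp add: euclidean_product_topology)
  have "(\<lambda>k. (q k + e n * r k) / (1 + e n * a)) \<in> closure S" for n
    using assms[OF e(2)] closure_subset by blast
  then show ?thesis
    by (intro Lim_in_closed_set[OF closed_closure _ trivial_limit_sequentially lim]
        always_eventually allI)
qed

lemma closure_pos_polys:
  fixes \<Lambda> :: "(int ^ 'd) set"
  assumes "finite \<Lambda>" "0 \<in> \<Lambda>"
  shows "closure (pos_polys \<Lambda>) = {q \<in> sym_coeffs \<Lambda>. \<forall>\<theta>\<in>torus. 0 \<le> trig_val \<Lambda> q \<theta>}"
proof
  show "closure (pos_polys \<Lambda>) \<subseteq> {q \<in> sym_coeffs \<Lambda>. \<forall>\<theta>\<in>torus. 0 \<le> trig_val \<Lambda> q \<theta>}"
    by (rule closure_minimal[OF _ closed_coeff_conditions(1)])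
      (auto simp: pos_polys_def intro: less_imp_le)
  define one where "one = (\<lambda>k :: int ^ 'd. if k = 0 then 1 else 0 :: real)"
  have one: "one \<in> sym_coeffs \<Lambda>" "\<And>\<theta>. trig_val \<Lambda> one \<theta> = 1"
    unfolding one_def using const_one_poly[OF assms] by auto
  show "{q \<in> sym_coeffs \<Lambda>. \<forall>\<theta>\<in>torus. 0 \<le> trig_val \<Lambda> q \<theta>} \<subseteq> closure (pos_polys \<Lambda>)"
  proof
    fix q assume q: "q \<in> {q \<in> sym_coeffs \<Lambda>. \<forall>\<theta>\<in>torus. 0 \<le> trig_val \<Lambda> q \<theta>}"
    show "q \<in> closure (pos_polys \<Lambda>)"
    proof (rule closure_perturbed[where r = one and a = 0])
      fix e :: real assume e: "0 < e"
      have "trig_val \<Lambda> (\<lambda>k. q k + e * one k) \<theta> = trig_val \<Lambda> q \<theta> + e" for \<theta>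
        using trig_val_add[of \<Lambda> 1 q e one \<theta>] one(2) by simp
      then show "(\<lambda>k. (q k + e * one k) / (1 + e * 0)) \<in> pos_polys \<Lambda>"
        using q one(1) e by (simp add: pos_polys_def sym_coeffs_def add_nonneg_pos)
    qed
  qed
qed

lemma closure_pos_polys_norm:
  fixes \<Lambda> :: "(int ^ 'd) set"
  assumes "finite \<Lambda>" "0 \<in> \<Lambda>"
  shows "closure (pos_polys_norm \<Lambda>) =
    {p \<in> sym_coeffs \<Lambda>. (\<forall>\<theta>\<in>torus. 0 \<le> trig_val \<Lambda> p \<theta>) \<and> p 0 = 1}" (is "_ = ?N")
proof
  have "?N = {q \<in> sym_coeffs \<Lambda>. \<forall>\<theta>\<in>torus. 0 \<le> trig_val \<Lambda> q \<theta>} \<inter> {q. q 0 = 1}"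
    by auto
  then have "closed ?N"
    by (simp only: closed_Int[OF closed_coeff_conditions])
  then show "closure (pos_polys_norm \<Lambda>) \<subseteq> ?N"
    by (rule closure_minimal[rotated])
      (auto simp: pos_polys_norm_def pos_polys_def intro: less_imp_le)
  define one where "one = (\<lambda>k :: int ^ 'd. if k = 0 then 1 else 0 :: real)"
  have one: "one \<in> sym_coeffs \<Lambda>" "\<And>\<theta>. trig_val \<Lambda> one \<theta> = 1" "one 0 = 1"
    using const_one_poly[OF assms] by (auto simp: one_def)
  show "?N \<subseteq> closure (pos_polys_norm \<Lambda>)"
  proof
    fix p assume p: "p \<in> ?N"
    show "p \<in> closure (pos_polys_norm \<Lambda>)"
    proof (rule closure_perturbed[where r = one and a = 1])
      fix e :: real assume e: "0 < e"
      have "(\<lambda>k. (p k + e * one k) / (1 + e * 1)) =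
          (\<lambda>k. (1 / (1 + e)) * p k + (e / (1 + e)) * one k)"
        by (simp add: add_divide_distrib)
      then have "trig_val \<Lambda> (\<lambda>k. (p k + e * one k) / (1 + e * 1)) \<theta> =
          (trig_val \<Lambda> p \<theta> + e) / (1 + e)" for \<theta>
        using trig_val_add[of \<Lambda> "1 / (1 + e)" p "e / (1 + e)" one \<theta>] one(2)
        by (simp add: add_divide_distrib)
      then show "(\<lambda>k. (p k + e * one k) / (1 + e * 1)) \<in> pos_polys_norm \<Lambda>"
        using p one(1,3) e
        by (simp add: pos_polys_norm_def pos_polys_def sym_coeffs_def add_nonneg_pos)
    qed
  qed
qed

end

theory Submission
  imports Defs "HOL-Complex_Analysis.Conformal_Mappings" "HOL-Real_Asymp.Real_Asymp"
begin

text \<open>Existence: feasibility makes \<open>\<langle>c, q\<rangle>\<close> coercive on the cone of nonnegative polynomials, the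
  constraint \<open>p\<^sub>0 = 1\<close> bounds \<open>p\<close>, and by Fatou the dual function is lower semicontinuous, so a
  minimizing sequence has a minimizing limit. The minimizer is interior: a nonnegative polynomial
  vanishes at least quadratically at a zero, so for \<open>2 \<nu> \<ge> d\<close> the integral of \<open>1 / P ^ \<nu>\<close> diverges if
  \<open>P\<close> has a zero, while a zero of \<open>Q\<close> makes the derivative in the direction of the constant
  polynomial \<open>- \<infinity>\<close>. The moment conditions are the vanishing of the gradient. Uniqueness holds
  because \<open>x ^ \<nu> / y ^ (\<nu> - 1)\<close> is jointly convex and degenerate only along rays, and
  \<open>1 / x ^ \<nu>\<close> removes this degeneracy.\<close>

section \<open>The torus\<close>

text \<open>Dimension d is reduced to lines: along a direction that separates the finitely many
  frequencies, a trigonometric polynomial becomes a one-variable exponential sum with distinct real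
  frequencies. This yields both the null zero sets and the bound |p_k| \<le> p_0. No integral is
  differentiated. All convexity arguments rest on one pointwise tangent inequality for
  \<open>J_val\<close>, which serves to bound the gain from raising Q, to compare the minimizer with
  perturbed pairs and, through its equality case, to prove uniqueness. The boundary is the main
  obstacle: \<open>dual_fun\<close> cuts out zero sets and prescribes the value at Q = 0. Arithmetic
  in \<open>ennreal\<close>, where 1 / 0 is infinite, absorbs both, so the minimization is carried
  out for the equivalent \<open>dual\<close>. The bound on d enters by scaling: over a cube of side
  s at a quadratic zero, the integral of the inverse \<nu>-th power is at least of order s^d / s^(2
  \<nu>), which does not tend to 0. This is applied to P and to Q alike.\<close>

lemma torus_subset_cbox: "torus \<subseteq> cbox 0 (\<chi> j. 2 * pi :: real ^ 'd)"
  by (auto simp: torus_def mem_box_cart less_imp_le)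

lemma torus_borel: "(torus :: (real ^ 'd) set) \<in> sets borel"
proof -
  have "(torus :: (real ^ 'd) set) = (\<Inter>j. {\<theta>. 0 < \<theta> $ j} \<inter> {\<theta>. \<theta> $ j \<le> 2 * pi})"
    by (auto simp: torus_def)
  also have "\<dots> \<in> sets borel"
    by (intro sets.finite_INT sets.Int borel_open borel_closed open_Collect_less closed_Collect_le
        continuous_intros) auto
  finally show ?thesis .
qed

lemma torus_lebesgue: "(torus :: (real ^ 'd) set) \<inter> space lebesgue \<in> sets lebesgue"
  using torus_borel by (auto intro: sets_completionI_sets)

lemma space_torus_measure: "space (torus_measure :: (real ^ 'd) measure) = torus"
  by (simp add: torus_measure_def)

lemma measurable_torus_measure:
  "f \<in> borel_measurable borel \<Longrightarrow> f \<in> borel_measurable (torus_measure :: (real ^ 'd) measure)"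
  unfolding torus_measure_def
  by (simp add: measurable_completion measurable_restrict_space1)

lemma AE_torus_measure_iff:
  "(AE x in (torus_measure :: (real ^ 'd) measure). R x) \<longleftrightarrow> (AE x in lborel. x \<in> torus \<longrightarrow> R x)"
  unfolding torus_measure_def
  by (simp add: AE_density AE_restrict_space_iff[OF torus_lebesgue] AE_completion_iff)

lemma AE_torus_measure_negligible:
  "negligible N \<Longrightarrow> AE x in (torus_measure :: (real ^ 'd) measure). x \<notin> N"
  unfolding AE_torus_measure_iff negligible_iff_null_sets
  by (metis (mono_tags, lifting) AE_completion_iff AE_not_in eventually_mono)

lemma AE_torus_measure_torus: "AE x in (torus_measure :: (real ^ 'd) measure). x \<in> torus"
  by (simp add: AE_torus_measure_iff)

lemma nn_integral_torus_measure:
  assumes "f \<in> borel_measurable borel"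
  shows "(\<integral>\<^sup>+x. f x \<partial>(torus_measure :: (real ^ 'd) measure)) =
    ennreal (1 / (2 * pi) ^ CARD('d)) * (\<integral>\<^sup>+x. f x * indicator torus x \<partial>lborel)"
proof -
  have "f \<in> borel_measurable (lebesgue_on torus)"
    using assms by (simp add: measurable_completion measurable_restrict_space1)
  then have "(\<integral>\<^sup>+x. f x \<partial>(torus_measure :: (real ^ 'd) measure)) =
      ennreal (1 / (2 * pi) ^ CARD('d)) * (\<integral>\<^sup>+x. f x \<partial>lebesgue_on torus)"
    unfolding torus_measure_def by (simp add: nn_integral_density nn_integral_cmult)
  also have "(\<integral>\<^sup>+x. f x \<partial>lebesgue_on torus) = (\<integral>\<^sup>+x. f x * indicator torus x \<partial>lborel)"
    using nn_integral_restrict_space[OF torus_lebesgue, of f] by (simp add: nn_integral_completion)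
  finally show ?thesis .
qed

lemma not_AE_torus_measure_outside_ball:
  fixes x :: "real ^ 'd"
  assumes "0 < r" "ball x r \<subseteq> torus" and "AE \<theta> in torus_measure. \<theta> \<notin> ball x r"
  shows False
proof -
  have "AE \<theta> in lborel. \<theta> \<notin> ball x r"
    using assms(3) unfolding AE_torus_measure_iff by (rule eventually_mono) (use assms(2) in auto)
  then have "ball x r \<in> null_sets lborel"
    using AE_iff_null_sets[of "ball x r" lborel] by simp
  then have "negligible (ball x r)"
    by (simp add: negligible_iff_null_sets null_sets_completionI)
  then show False
    using open_not_negligible[of "ball x r"] assms(1) by auto
qed

lemma finite_measure_torus: "finite_measure (torus_measure :: (real ^ 'd) measure)"
proof
  have "emeasure (torus_measure :: (real ^ 'd) measure) torus =
      (\<integral>\<^sup>+x. 1 \<partial>(torus_measure :: (real ^ 'd) measure))"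
    by (simp add: space_torus_measure)
  also have "\<dots> = ennreal (1 / (2 * pi) ^ CARD('d)) * emeasure lborel (torus :: (real ^ 'd) set)"
    by (subst nn_integral_torus_measure) (simp_all add: torus_borel)
  also have "\<dots> \<le> ennreal (1 / (2 * pi) ^ CARD('d)) * emeasure lborel (cbox 0 (\<chi> j. 2 * pi :: real ^ 'd))"
    by (intro mult_left_mono emeasure_mono torus_subset_cbox) auto
  also have "\<dots> < \<infinity>"
    using emeasure_lborel_cbox_finite[of 0 "\<chi> j. 2 * pi :: real ^ 'd"]
    by (simp add: ennreal_mult_less_top)
  finally show "emeasure torus_measure (space (torus_measure :: (real ^ 'd) measure)) \<noteq> \<infinity>"
    by (simp add: space_torus_measure)
qed

lemma integrable_torus_measure_bounded:
  fixes f :: "real ^ 'd \<Rightarrow> 'b :: {banach, second_countable_topology}"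
  assumes "f \<in> borel_measurable borel" "\<And>x. norm (f x) \<le> B"
  shows "integrable torus_measure f"
  using finite_measure.integrable_const_bound[OF finite_measure_torus, of f B]
    measurable_torus_measure[OF assms(1)] assms(2) by auto

text \<open>The closed cube replaces the half-open torus because it is invariant under the
  reflection \<theta> -> 2 pi - \<theta>, which is substituted later.\<close>

lemma integral_torus_measure:
  fixes f :: "real ^ 'd \<Rightarrow> 'b :: {banach, second_countable_topology}"
  assumes [measurable]: "f \<in> borel_measurable borel"
  shows "(LINT x|torus_measure. f x) =
    (1 / (2 * pi) ^ CARD('d)) *\<^sub>R (LINT x|lborel. indicator (cbox 0 (\<chi> j. 2 * pi)) x *\<^sub>R f x)"
proof -
  note torus_borel[measurable]
  have fm: "f \<in> borel_measurable (lebesgue_on torus)"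
    by (simp add: measurable_completion measurable_restrict_space1)
  have "(LINT x|torus_measure. f x) =
      (1 / (2 * pi) ^ CARD('d)) *\<^sub>R (LINT x|lebesgue_on torus. f x)"
    unfolding torus_measure_def using fm by (subst integral_density) auto
  also have "(LINT x|lebesgue_on torus. f x) = (LINT x|lebesgue. indicator torus x *\<^sub>R f x)"
    by (rule integral_restrict_space[OF torus_lebesgue])
  also have "\<dots> = (LINT x|lborel. indicator torus x *\<^sub>R f x)"
    by (rule integral_completion) measurable
  also have "\<dots> = (LINT x|lborel. indicator (cbox 0 (\<chi> j. 2 * pi)) x *\<^sub>R f x)"
  proof (rule integral_cong_AE)
    \<comment> \<open>Torus and cube differ only on the coordinate hyperplanes.\<close>
    have "negligible (\<Union>j. {x :: real ^ 'd. axis j 1 \<bullet> x = 0})"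
      by (intro negligible_Union finite_imageI) (auto intro!: negligible_hyperplane simp: axis_eq_0_iff)
    then have "AE x in lborel. x \<notin> (\<Union>j. {x :: real ^ 'd. axis j 1 \<bullet> x = 0})"
      unfolding negligible_iff_null_sets by (metis AE_completion_iff AE_not_in)
    then show "AE x in lborel. indicator torus x *\<^sub>R f x = indicator (cbox 0 (\<chi> j. 2 * pi)) x *\<^sub>R f x"
      by (rule eventually_mono)
        (auto simp: torus_def mem_box_cart inner_axis' indicator_def less_le)
  qed measurable
  finally show ?thesis .
qed

section \<open>Characters, periodicity and bounds for polynomial values\<close>

lemma pairing_eq_inner: "pairing k \<theta> = (\<chi> j. real_of_int (k $ j)) \<bullet> \<theta>"
  by (simp add: pairing_def inner_vec_def)

lemma pairing_add: "pairing k (x + y) = pairing k x + pairing k y"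
  by (simp add: pairing_eq_inner inner_add_right)

lemma pairing_diff: "pairing k (x - y) = pairing k x - pairing k y"
  by (simp add: pairing_eq_inner inner_diff_right)

lemma pairing_scaleR: "pairing k (t *\<^sub>R x) = t * pairing k x"
  by (simp add: pairing_eq_inner)

lemma pairing_diff_left: "pairing (k - l) x = pairing k x - pairing l x"
  by (simp add: pairing_def left_diff_distrib sum_subtractf)

lemma pairing_zero [simp]: "pairing 0 x = 0"
  by (simp add: pairing_def)

lemma pairing_period: "pairing k (\<chi> j. 2 * pi * real_of_int (n j)) = 2 * pi * real_of_int (\<Sum>j\<in>UNIV. k $ j * n j)"
  by (simp add: pairing_def sum_distrib_left mult_ac)

lemma continuous_on_pairing [continuous_intros]:
  "continuous_on S f \<Longrightarrow> continuous_on S (\<lambda>x. pairing k (f x))"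
  unfolding pairing_eq_inner by (intro continuous_intros)

lemma continuous_on_trig_val: "continuous_on S (trig_val \<Lambda> q)"
  unfolding trig_val_sum[abs_def] by (intro continuous_intros)

lemma measurable_pairing [measurable]: "pairing k \<in> borel_measurable borel"
  by (intro borel_measurable_continuous_onI continuous_on_pairing continuous_on_id)

lemma measurable_trig_val [measurable]: "trig_val \<Lambda> q \<in> borel_measurable borel"
  by (intro borel_measurable_continuous_onI continuous_on_trig_val)

text \<open>Periodicity: sign conditions imposed on the torus hold on the whole space, where points
  may be shifted freely.\<close>

lemma torus_representative:
  fixes \<theta> :: "real ^ 'd"
  obtains \<theta>' where "\<theta>' \<in> torus" "\<And>\<Lambda> q. trig_val \<Lambda> q \<theta>' = trig_val \<Lambda> q \<theta>"
proof -
  \<comment> \<open>A ceiling rather than a floor, since each coordinate interval is open at 0 and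
    closed at 2 pi.\<close>
  define n where "n j = 1 - \<lceil>\<theta> $ j / (2 * pi)\<rceil>" for j
  define \<theta>' where "\<theta>' = \<theta> + (\<chi> j. 2 * pi * real_of_int (n j))"
  have "\<theta>' $ j = 2 * pi * (\<theta> $ j / (2 * pi) + 1 - real_of_int \<lceil>\<theta> $ j / (2 * pi)\<rceil>)" for j
    by (simp add: \<theta>'_def n_def algebra_simps)
  moreover have "0 < \<theta> $ j / (2 * pi) + 1 - real_of_int \<lceil>\<theta> $ j / (2 * pi)\<rceil>"
    "\<theta> $ j / (2 * pi) + 1 - real_of_int \<lceil>\<theta> $ j / (2 * pi)\<rceil> \<le> 1" for j
    by linarith+
  ultimately have "\<theta>' \<in> torus"
    by (simp add: torus_def mult_left_le)
  moreover have "cos (pairing k \<theta>') = cos (pairing k \<theta>)" for k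
    unfolding \<theta>'_def pairing_add pairing_period cos_add cos_int_2pin sin_int_2pin by simp
  then have "trig_val \<Lambda> q \<theta>' = trig_val \<Lambda> q \<theta>" for \<Lambda> q
    by (simp add: trig_val_sum)
  ultimately show thesis by (rule that)
qed

lemma trig_val_nonneg: "\<forall>\<theta>\<in>torus. 0 \<le> trig_val \<Lambda> q \<theta> \<Longrightarrow> 0 \<le> trig_val \<Lambda> q \<theta>"
  by (metis torus_representative)

text \<open>The torus as a subset of the space is not compact, so the minimum is taken over the
  closed cube, and periodicity moves the minimizing point back into the torus.\<close>

lemma trig_val_pos_bound:
  fixes \<Lambda> :: "(int ^ 'd) set"
  assumes "\<forall>\<theta>\<in>torus. 0 < trig_val \<Lambda> q \<theta>"
  obtains \<delta> where "0 < \<delta>" "\<And>\<theta>. \<delta> \<le> trig_val \<Lambda> q \<theta>"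
proof -
  let ?K = "cbox 0 (\<chi> j. 2 * pi :: real ^ 'd)"
  have "0 \<in> ?K" by (simp add: mem_box_cart)
  then obtain x where x: "\<forall>y\<in>?K. trig_val \<Lambda> q x \<le> trig_val \<Lambda> q y"
    using continuous_attains_inf[OF compact_cbox _ continuous_on_trig_val[of ?K \<Lambda> q]] by blast
  show thesis
  proof
    show "0 < trig_val \<Lambda> q x"
      by (metis assms torus_representative)
    show "trig_val \<Lambda> q x \<le> trig_val \<Lambda> q \<theta>" for \<theta>
      by (metis x torus_representative torus_subset_cbox subsetD)
  qed
qed

lemma abs_trig_val_le:
  "\<bar>trig_val \<Lambda> q \<theta>\<bar> \<le> (\<Sum>k\<in>\<Lambda>. \<bar>q k\<bar>)"
  unfolding trig_val_sum
  by (rule order_trans[OF sum_abs sum_mono]) (simp add: abs_mult mult_left_le)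

text \<open>The reflection \<theta> -> 2 pi - \<theta> negates the sine and fixes \<open>f\<close>.
  This kills the imaginary parts of the moments.\<close>

lemma integral_torus_sin_eq_0:
  fixes f :: "real ^ 'd \<Rightarrow> real"
  assumes [measurable]: "f \<in> borel_measurable borel"
    and sym: "\<And>\<theta>. f ((\<chi> j. 2 * pi) - \<theta>) = f \<theta>"
  shows "(LINT \<theta>|torus_measure. sin (pairing k \<theta>) * f \<theta>) = 0"
proof -
  let ?c = "\<chi> j. 2 * pi :: real ^ 'd"
  let ?g = "\<lambda>x. indicator (cbox 0 ?c) x *\<^sub>R (sin (pairing k x) * f x)"
  have c: "?c = (\<chi> j. 2 * pi * real_of_int 1)" by simp
  have sin: "sin (pairing k (?c - x)) = - sin (pairing k x)" for x
    unfolding pairing_diff by (subst c, unfold pairing_period sin_diff cos_int_2pin sin_int_2pin) simp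
  have "distr lborel borel (\<lambda>x. ?c + (-1) *\<^sub>R x) = lborel"
    using lborel_affine[of "-1" ?c] by (simp add: density_1)
  then have "(LINT x|lborel. ?g x) = (LINT x|distr lborel borel (\<lambda>x. ?c + (-1) *\<^sub>R x). ?g x)"
    by simp
  also have "\<dots> = (LINT x|lborel. ?g (?c + (-1) *\<^sub>R x))"
    by (rule integral_distr) measurable
  also have "\<dots> = (LINT x|lborel. - ?g x)"
  proof (intro Bochner_Integration.integral_cong refl)
    fix x
    have "?c - x \<in> cbox 0 ?c \<longleftrightarrow> x \<in> cbox 0 ?c"
      by (auto simp: mem_box_cart)
    then show "?g (?c + (-1) *\<^sub>R x) = - ?g x"
      using sin[of x] sym[of x] by (simp add: indicator_def)
  qed
  finally have "(LINT x|lborel. ?g x) = 0" by simp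
  then show ?thesis
    by (subst integral_torus_measure) auto
qed

section \<open>Zero sets of trigonometric polynomials\<close>

text \<open>The bad directions lie in finitely many hyperplanes, one for each nonzero difference of
  two indices, and these do not fill the space.\<close>

lemma exists_separating_direction:
  fixes \<Lambda> :: "(int ^ 'd) set"
  assumes "finite \<Lambda>"
  obtains v where "inj_on (\<lambda>k. pairing k v) \<Lambda>"
proof -
  let ?h = "\<lambda>k :: int ^ 'd. {x :: real ^ 'd. (\<chi> j. real_of_int (k $ j)) \<bullet> x = 0}"
  let ?N = "\<Union>(?h ` ((\<lambda>(k, l). k - l) ` (\<Lambda> \<times> \<Lambda>) - {0}))"
  have "negligible ?N"
    using assms
    by (intro negligible_Union finite_imageI finite_Diff finite_cartesian_product)
      (auto intro!: negligible_hyperplane simp: vec_eq_iff)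
  then have "?N \<noteq> UNIV"
    using open_not_negligible[of "UNIV :: (real ^ 'd) set"] by auto
  then obtain v where v: "v \<notin> ?N" by blast
  have "k = l" if "k \<in> \<Lambda>" "l \<in> \<Lambda>" "pairing k v = pairing l v" for k l
  proof (rule ccontr)
    assume "k \<noteq> l"
    moreover have "pairing (k - l) v = 0"
      using that(3) by (simp add: pairing_diff_left)
    ultimately show False
      using v that(1,2) unfolding pairing_eq_inner by force
  qed
  then show thesis
    by (intro that inj_onI)
qed

text \<open>The sum extends to an entire function \<open>f\<close>, and an entire function that is
  not constant has countably many zeros. That \<open>f\<close> is not identically zero is seen on
  the negative imaginary axis, where the exponentials become real and the largest frequency
  dominates.\<close>

lemma countable_zeros_exp_sum:
  fixes a :: "'k \<Rightarrow> complex" and w :: "'k \<Rightarrow> real"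
  assumes "finite A" "inj_on w A" "l \<in> A" "a l \<noteq> 0"
  shows "countable {t :: real. (\<Sum>k\<in>A. a k * exp (\<i> * of_real (w k) * of_real t)) = 0}"
proof -
  define f where "f z = (\<Sum>k\<in>A. a k * exp (\<i> * of_real (w k) * z))" for z
  define B where "B = {k\<in>A. a k \<noteq> 0}"
  have B: "finite B" "B \<noteq> {}" using assms by (auto simp: B_def)
  have "Max (w ` B) \<in> w ` B" using B by simp
  \<comment> \<open>\<open>k1\<close> carries the largest frequency among the nonzero
    coefficients.\<close>
  then obtain k1 where k1: "k1 \<in> B" "w k1 = Max (w ` B)" by auto
  then have k1_max: "w k \<le> w k1" if "k \<in> B" for k
    using that B by simp
  have ne: "\<exists>z. f z \<noteq> 0"
  proof (rule ccontr)
    assume "\<not> ?thesis"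
    \<comment> \<open>Dividing f (- i y) by exp (w k1 * y) leaves \<open>a k1\<close> plus decaying
      terms, so f = 0 would force \<open>a k1 = 0\<close>.\<close>
    then have f0: "f z = 0" for z by blast
    have "((\<lambda>y. a k * of_real (exp ((w k - w k1) * y))) \<longlongrightarrow> (if k = k1 then a k1 else 0)) at_top"
      if "k \<in> A" for k
    proof (cases "k = k1 \<or> k \<notin> B")
      case True
      then show ?thesis using that k1(1) by (auto simp: B_def)
    next
      case False
      then have "w k < w k1"
        using k1(1) k1_max[of k] that assms(2) by (auto simp: B_def inj_on_def less_le)
      then have "((\<lambda>y. exp ((w k - w k1) * y)) \<longlongrightarrow> 0) at_top"
        by real_asymp
      then have "((\<lambda>y. a k * of_real (exp ((w k - w k1) * y))) \<longlongrightarrow> a k * of_real 0) at_top"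
        by (intro tendsto_intros)
      then show ?thesis using False by simp
    qed
    then have "((\<lambda>y. \<Sum>k\<in>A. a k * of_real (exp ((w k - w k1) * y))) \<longlongrightarrow>
        (\<Sum>k\<in>A. if k = k1 then a k1 else 0)) at_top"
      by (rule tendsto_sum)
    moreover have "(\<Sum>k\<in>A. if k = k1 then a k1 else 0) = a k1"
      using assms(1) k1(1) by (simp add: B_def)
    moreover have "(\<Sum>k\<in>A. a k * of_real (exp ((w k - w k1) * y))) = 0" for y
    proof -
      have "a k * of_real (exp ((w k - w k1) * y)) =
          of_real (exp (- w k1 * y)) * (a k * exp (\<i> * of_real (w k) * (- \<i> * of_real y)))" for k
      proof -
        have "\<i> * of_real (w k) * (- \<i> * of_real y) = of_real (w k * y)"
          by (simp add: complex_eq_iff)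
        then show ?thesis
          by (simp only: exp_of_real) (simp add: left_diff_distrib exp_diff exp_minus field_simps)
      qed
      then have "(\<Sum>k\<in>A. a k * of_real (exp ((w k - w k1) * y))) =
          of_real (exp (- w k1 * y)) * f (- \<i> * of_real y)"
        unfolding f_def sum_distrib_left by (intro sum.cong refl)
      then show ?thesis by (simp add: f0)
    qed
    ultimately have "((\<lambda>_ :: real. 0) \<longlongrightarrow> a k1) at_top" by simp
    then have "a k1 = 0"
      using tendsto_unique[OF trivial_limit_at_top_linorder _ tendsto_const] by blast
    then show False using k1(1) by (simp add: B_def)
  qed
  have hol: "f holomorphic_on UNIV"
    unfolding f_def by (intro holomorphic_intros)
  have "countable {z \<in> UNIV. f z = 0}"
  proof (cases "f constant_on UNIV")
    case True
    then obtain c where "\<And>z. f z = c" by (auto simp: constant_on_def)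
    then show ?thesis using ne by simp
  next
    case False
    then show ?thesis
      using hol by (intro holomorphic_countable_zeros) auto
  qed
  then have "countable ((of_real :: real \<Rightarrow> complex) ` {t. f (of_real t) = 0})"
    by (rule countable_subset[rotated]) auto
  then have "countable {t. f (of_real t) = 0}"
    by (rule countable_image_inj_on) (simp add: inj_on_def)
  then show ?thesis by (simp add: f_def)
qed

text \<open>All translates of \<open>Z\<close> along \<open>v\<close> have the same measure; average it over \<open>t \<in> [0, 1]\<close> and apply
  Fubini.\<close>

lemma null_sets_lborel_lines:
  fixes Z :: "'a :: euclidean_space set"
  assumes Z[measurable]: "Z \<in> sets borel" and null: "\<And>x. {t. x + t *\<^sub>R v \<in> Z} \<in> null_sets lborel"
  shows "Z \<in> null_sets lborel"
proof -
  let ?f = "\<lambda>(x :: 'a, t :: real). indicator Z (x + t *\<^sub>R v) * indicator {0..1} t :: ennreal"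
  have "emeasure lborel Z = (\<integral>\<^sup>+t. emeasure lborel Z * indicator {0..1 :: real} t \<partial>lborel)"
    by (simp add: nn_integral_cmult_indicator)
  also have "\<dots> = (\<integral>\<^sup>+t. \<integral>\<^sup>+x. ?f (x, t) \<partial>lborel \<partial>lborel)"
  proof (intro nn_integral_cong)
    fix t :: real
    have "emeasure lborel Z = (\<integral>\<^sup>+x. indicator Z x \<partial>distr lborel borel ((+) (t *\<^sub>R v)))"
      by (simp add: lborel_distr_plus)
    also have "\<dots> = (\<integral>\<^sup>+x. indicator Z (t *\<^sub>R v + x) \<partial>lborel)"
      by (rule nn_integral_distr) auto
    finally show "emeasure lborel Z * indicator {0..1} t = (\<integral>\<^sup>+x. ?f (x, t) \<partial>lborel)"
      by (simp add: nn_integral_multc add.commute)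
  qed
  also have "\<dots> = (\<integral>\<^sup>+x. \<integral>\<^sup>+t. ?f (x, t) \<partial>lborel \<partial>lborel)"
  proof (rule lborel_pair.Fubini)
    show "?f \<in> borel_measurable (lborel \<Otimes>\<^sub>M lborel)"
      unfolding split_beta' by measurable
  qed
  also have "\<dots> = (\<integral>\<^sup>+x. 0 \<partial>(lborel :: 'a measure))"
  proof (intro nn_integral_cong)
    fix x
    have "AE t in lborel. ?f (x, t) = 0"
      using AE_not_in[OF null[of x]] by (rule eventually_mono) (simp add: indicator_def)
    then show "(\<integral>\<^sup>+t. ?f (x, t) \<partial>lborel) = 0"
      by (subst nn_integral_0_iff_AE) auto
  qed
  finally show ?thesis by (auto simp: null_sets_def)
qed

text \<open>On every line in a separating direction the polynomial is an exponential sum with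
  distinct frequencies and a nonzero coefficient, so its zeros there are countable. A Borel set that
  is null on all parallel lines is null.\<close>

lemma negligible_trig_val_zeros:
  fixes \<Lambda> :: "(int ^ 'd) set"
  assumes "finite \<Lambda>" "uminus ` \<Lambda> = \<Lambda>" "q \<in> sym_coeffs \<Lambda>" "q \<noteq> (\<lambda>_. 0)"
  shows "negligible {\<theta>. trig_val \<Lambda> q \<theta> = 0}"
proof -
  let ?Z = "{\<theta>. trig_val \<Lambda> q \<theta> = 0}"
  obtain v where v: "inj_on (\<lambda>k. pairing k v) \<Lambda>"
    using exists_separating_direction[OF assms(1)] .
  obtain k0 where k0: "q k0 \<noteq> 0" using assms(4) by blast
  then have "k0 \<in> \<Lambda>" using assms(3) by (auto simp: sym_coeffs_def)
  have "?Z \<in> null_sets lborel"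
  proof (rule null_sets_lborel_lines)
    fix x
    let ?a = "\<lambda>k. of_real (q k) * exp (- (\<i> * of_real (pairing k x)))"
    have eq: "of_real (trig_val \<Lambda> q (x + t *\<^sub>R v)) =
        (\<Sum>k\<in>\<Lambda>. ?a k * exp (\<i> * of_real (- pairing k v) * of_real t))" for t
      unfolding of_real_trig_val[OF assms(2,3)] trig_poly_def
      by (intro sum.cong refl)
        (simp add: mult.assoc pairing_add pairing_scaleR exp_add[symmetric], simp add: algebra_simps)
    have "{t. x + t *\<^sub>R v \<in> ?Z} =
        {t. (\<Sum>k\<in>\<Lambda>. ?a k * exp (\<i> * of_real (- pairing k v) * of_real t)) = 0}"
      by (simp only: eq[symmetric] of_real_eq_0_iff mem_Collect_eq)
    also have "countable \<dots>"
      using assms(1) v \<open>k0 \<in> \<Lambda>\<close> k0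
      by (intro countable_zeros_exp_sum[where l = k0]) (auto simp: inj_on_def)
    finally show "{t. x + t *\<^sub>R v \<in> ?Z} \<in> null_sets lborel"
      by (rule countable_imp_null_set_lborel)
  qed measurable
  then show ?thesis
    by (simp add: negligible_iff_null_sets null_sets_completionI)
qed

lemma AE_trig_val_nonzero:
  fixes \<Lambda> :: "(int ^ 'd) set"
  assumes "finite \<Lambda>" "uminus ` \<Lambda> = \<Lambda>" "q \<in> sym_coeffs \<Lambda>" "q \<noteq> (\<lambda>_. 0)"
  shows "AE \<theta> in torus_measure. trig_val \<Lambda> q \<theta> \<noteq> 0"
  using AE_torus_measure_negligible[OF negligible_trig_val_zeros[OF assms]] by simp

text \<open>This turns positivity of the feasible density on a single ball into strict positivity on
  the whole cone of nonnegative polynomials.\<close>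

lemma trig_val_AE_zero_imp:
  fixes \<Lambda> :: "(int ^ 'd) set"
  assumes "finite \<Lambda>" "uminus ` \<Lambda> = \<Lambda>" "q \<in> sym_coeffs \<Lambda>"
    and "AE \<theta> in torus_measure. \<theta> \<in> ball x r \<longrightarrow> trig_val \<Lambda> q \<theta> = 0"
    and "0 < r" "ball x r \<subseteq> torus"
  shows "q = (\<lambda>_. 0)"
proof (rule ccontr)
  assume "q \<noteq> (\<lambda>_. 0)"
  from AE_trig_val_nonzero[OF assms(1-3) this] assms(4)
  have "AE \<theta> in torus_measure. \<theta> \<notin> ball x r"
    by eventually_elim auto
  then show False
    using not_AE_torus_measure_outside_ball assms(5,6) by blast
qed

lemma inverse_ennreal_antimono: "x \<le> y \<Longrightarrow> inverse y \<le> inverse (x :: ennreal)"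
  by (simp add: less_eq_ennreal.rep_eq inverse_ennreal.rep_eq ereal_inverse_antimono)

section \<open>Non-integrability at a zero\<close>

text \<open>No derivatives are needed: \<open>P(\<theta> + h) \<le> P(\<theta> + h) + P(\<theta> - h) - 2 P(\<theta>)\<close>, and the second
  difference of a cosine is quadratically small.\<close>

lemma trig_val_quadratic_bound:
  fixes \<Lambda> :: "(int ^ 'd) set"
  assumes "\<forall>\<theta>\<in>torus. 0 \<le> trig_val \<Lambda> p \<theta>" "trig_val \<Lambda> p \<theta> = 0"
  obtains C where "0 < C" "\<And>h. trig_val \<Lambda> p (\<theta> + h) \<le> C * (norm h)\<^sup>2"
proof -
  let ?K = "\<lambda>k :: int ^ 'd. \<chi> j. real_of_int (k $ j)"
  \<comment> \<open>The summand 1 keeps \<open>C\<close> positive even if every other term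
    vanishes.\<close>
  define C where "C = 1 + (\<Sum>k\<in>\<Lambda>. \<bar>p k\<bar> * (norm (?K k))\<^sup>2)"
  have C: "0 < C" unfolding C_def by (intro add_pos_nonneg sum_nonneg) auto
  have cosle: "1 - cos x \<le> x\<^sup>2 / 2" for x :: real
  proof -
    have "1 - cos x = 2 * (sin (x / 2))\<^sup>2"
      using cos_double_sin[of "x / 2"] by simp
    also have "\<dots> \<le> 2 * (x / 2)\<^sup>2"
      using abs_sin_x_le_abs_x[of "x / 2"] unfolding abs_le_square_iff by simp
    finally show ?thesis by (simp add: power_divide)
  qed
  have "trig_val \<Lambda> p (\<theta> + h) \<le> C * (norm h)\<^sup>2" for h
  proof -
    have "0 \<le> trig_val \<Lambda> p (\<theta> - h)" using trig_val_nonneg[OF assms(1)] .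
    then have "trig_val \<Lambda> p (\<theta> + h) \<le>
        trig_val \<Lambda> p (\<theta> + h) + trig_val \<Lambda> p (\<theta> - h) - 2 * trig_val \<Lambda> p \<theta>"
      using assms(2) by simp
    also have "\<dots> = (\<Sum>k\<in>\<Lambda>. 2 * p k * cos (pairing k \<theta>) * (cos (pairing k h) - 1))"
      unfolding trig_val_sum pairing_add pairing_diff cos_add cos_diff
      unfolding sum_distrib_left sum.distrib[symmetric] sum_subtractf[symmetric]
      by (intro sum.cong refl) (simp add: algebra_simps)
    also have "\<dots> \<le> (\<Sum>k\<in>\<Lambda>. \<bar>p k\<bar> * (norm (?K k))\<^sup>2 * (norm h)\<^sup>2)"
    proof (rule sum_mono)
      fix k
      have "2 * p k * cos (pairing k \<theta>) * (cos (pairing k h) - 1) \<le>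
          \<bar>2 * p k * cos (pairing k \<theta>) * (cos (pairing k h) - 1)\<bar>" by simp
      also have "\<dots> = \<bar>p k\<bar> * \<bar>cos (pairing k \<theta>)\<bar> * (2 * (1 - cos (pairing k h)))"
        by (simp add: abs_mult)
      also have "\<dots> \<le> \<bar>p k\<bar> * 1 * (pairing k h)\<^sup>2"
        using cosle[of "pairing k h"] by (intro mult_mono) auto
      also have "(pairing k h)\<^sup>2 \<le> (norm (?K k) * norm h)\<^sup>2"
        unfolding pairing_eq_inner using Cauchy_Schwarz_ineq2[of "?K k" h]
        by (intro power2_le_iff_abs_le[THEN iffD2]) auto
      finally show "2 * p k * cos (pairing k \<theta>) * (cos (pairing k h) - 1) \<le>
          \<bar>p k\<bar> * (norm (?K k))\<^sup>2 * (norm h)\<^sup>2"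
        by (simp add: power_mult_distrib mult.assoc mult_left_mono)
    qed
    also have "\<dots> \<le> C * (norm h)\<^sup>2"
      unfolding C_def by (simp add: sum_distrib_right distrib_right)
    finally show ?thesis .
  qed
  then show thesis using C that by blast
qed

text \<open>If the integral were finite, its part over the corner cubes \<open>[\<theta> - s, \<theta>]\<close> would vanish
  as \<open>s \<rightarrow> 0\<close>; but it is at least a constant times \<open>s ^ d * s powr (- 2 \<nu>)\<close>.\<close>

lemma nn_integral_inverse_power_infinite:
  fixes \<Lambda> :: "(int ^ 'd) set"
  assumes nonneg: "\<forall>\<theta>\<in>torus. 0 \<le> trig_val \<Lambda> p \<theta>" and \<theta>: "\<theta> \<in> torus" "trig_val \<Lambda> p \<theta> = 0"
    and dim: "CARD('d) \<le> 2 * \<nu>"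
  shows "(\<integral>\<^sup>+x. 1 / ennreal (trig_val \<Lambda> p x) ^ \<nu> \<partial>torus_measure) = \<infinity>"
proof (rule ccontr)
  assume fin: "\<not> ?thesis"
  let ?one = "(\<chi> j. 1) :: real ^ 'd"
  obtain C where C: "0 < C" "\<And>h. trig_val \<Lambda> p (\<theta> + h) \<le> C * (norm h)\<^sup>2"
    using trig_val_quadratic_bound[OF nonneg \<theta>(2)] by blast
  \<comment> \<open>Cubes with upper corner \<open>\<theta>\<close> and side below \<open>r\<close>
    stay inside the torus, also when a coordinate of \<open>\<theta>\<close> equals 2 pi.\<close>
  define r where "r = min 1 (Min (range (($) \<theta>)))"
  have r: "0 < r" "r \<le> 1" "\<And>j. r \<le> \<theta> $ j"
    using \<theta>(1) by (auto simp: r_def torus_def Min_gr_iff min_le_iff_disj)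
  define s where "s n = r / (real n + 2)" for n
  have s: "0 < s n" "s n < r" "s n \<le> 1" for n
    using r by (auto simp: s_def field_simps add_pos_nonneg intro: order_trans)
  define Q where "Q n = cbox (\<theta> - s n *\<^sub>R ?one) \<theta>" for n
  define f where "f x = 1 / ennreal (trig_val \<Lambda> p x) ^ \<nu> * indicator torus x" for x
  have f[measurable]: "f \<in> borel_measurable borel"
    unfolding f_def using torus_borel by measurable
  define M where "M = density lborel f"
  have Qtorus: "Q n \<subseteq> torus" for n
  proof
    fix x assume "x \<in> Q n"
    then have x: "\<theta> $ j - s n \<le> x $ j" "x $ j \<le> \<theta> $ j" for j
      by (auto simp: Q_def mem_box_cart)
    have "0 < x $ j \<and> x $ j \<le> 2 * pi" for j
      using x[of j] s(2)[of n] r(3)[of j] \<theta>(1) by (auto simp: torus_def intro: order_trans)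
    then show "x \<in> torus" by (simp add: torus_def)
  qed
  have EM: "emeasure M A = (\<integral>\<^sup>+x. f x * indicator A x \<partial>lborel)" if "A \<in> sets borel" for A
    unfolding M_def using that by (subst emeasure_density) auto
  have total: "emeasure M UNIV < \<infinity>"
  proof -
    have "(\<integral>\<^sup>+x. 1 / ennreal (trig_val \<Lambda> p x) ^ \<nu> \<partial>torus_measure) =
        ennreal (1 / (2 * pi) ^ CARD('d)) * emeasure M UNIV"
      by (subst nn_integral_torus_measure) (auto simp: EM f_def)
    then show ?thesis
      using fin by (auto simp: ennreal_mult_eq_top_iff less_top)
  qed
  have dec: "decseq Q"
  proof (rule decseq_SucI)
    fix n
    have "s (Suc n) \<le> s n"
      using r by (simp add: s_def field_simps)
    then have "\<theta> $ j - s n \<le> x $ j" if "\<theta> $ j - s (Suc n) \<le> x $ j" for x j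
      using that by linarith
    then show "Q (Suc n) \<subseteq> Q n"
      by (auto simp: Q_def mem_box_cart)
  qed
  \<comment> \<open>Continuity from above applies because the integral was assumed finite.\<close>
  have "(\<lambda>n. emeasure M (Q n)) \<longlonglongrightarrow> emeasure M (\<Inter>n. Q n)"
  proof (rule Lim_emeasure_decseq)
    show "range Q \<subseteq> sets M" by (auto simp: Q_def M_def)
    show "emeasure M (Q n) \<noteq> \<infinity>" for n
      using emeasure_mono[of "Q n" UNIV M] total by (auto simp: M_def top_unique)
  qed (rule dec)
  moreover have "emeasure M (\<Inter>n. Q n) = 0"
  proof -
    have "s \<longlonglongrightarrow> 0" unfolding s_def by real_asymp
    have "(\<Inter>n. Q n) \<subseteq> {\<theta>}"
    proof
      fix x assume "x \<in> (\<Inter>n. Q n)"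
      then have x: "\<theta> $ j - s n \<le> x $ j" "x $ j \<le> \<theta> $ j" for j n
        by (auto simp: Q_def mem_box_cart)
      have "\<theta> $ j \<le> x $ j" for j
        using LIMSEQ_le_const2[OF tendsto_diff[OF tendsto_const[of "\<theta> $ j"] \<open>s \<longlonglongrightarrow> 0\<close>], of "x $ j"] x(1)
        by auto
      then show "x \<in> {\<theta>}" using x(2) by (simp add: vec_eq_iff order_antisym)
    qed
    then have "emeasure M (\<Inter>n. Q n) \<le> emeasure M {\<theta>}"
      by (rule emeasure_mono) (simp add: M_def)
    also have "\<dots> = (\<integral>\<^sup>+x. f x * indicator {\<theta>} x \<partial>lborel)"
      by (rule EM) simp
    also have "\<dots> = 0"
      using AE_lborel_singleton[of \<theta>] by (subst nn_integral_0_iff_AE) (auto simp: indicator_def)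
    finally show ?thesis by simp
  qed
  ultimately have lim: "(\<lambda>n. emeasure M (Q n)) \<longlonglongrightarrow> 0" by simp
  \<comment> \<open>On the cube of side s the squared distance to \<open>\<theta>\<close> is at most
    d s^2, so P is at most C d s^2. Multiplied by the volume s^d this gives \<open>K\<close> times
    s^d / s^(2 \<nu>), and the last factor is at least 1 because s \<le> 1 and d \<le> 2
    \<nu>.\<close>
  define K where "K = 1 / (C * real CARD('d)) ^ \<nu>"
  have K: "0 < K" using C(1) by (simp add: K_def)
  have "ennreal K \<le> emeasure M (Q n)" for n
  proof -
    have "1 \<le> s n ^ CARD('d) / s n ^ (2 * \<nu>)"
      using s[of n] dim by (simp add: power_decreasing)
    then have "K * 1 \<le> K * (s n ^ CARD('d) / s n ^ (2 * \<nu>))"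
      using K by (intro mult_left_mono) auto
    also have "\<dots> = 1 / ((C * real CARD('d)) * (s n)\<^sup>2) ^ \<nu> * s n ^ CARD('d)"
      by (simp add: K_def power_mult_distrib power_mult)
    finally have "K \<le> 1 / ((C * real CARD('d)) * (s n)\<^sup>2) ^ \<nu> * s n ^ CARD('d)"
      by simp
    then have "ennreal K \<le> ennreal (1 / ((C * real CARD('d)) * (s n)\<^sup>2) ^ \<nu>) * ennreal (s n ^ CARD('d))"
      using s[of n] C(1) by (simp add: ennreal_leI flip: ennreal_mult)
    also have "ennreal (s n ^ CARD('d)) = emeasure lborel (Q n)"
    proof -
      have "(\<Prod>b\<in>Basis. (\<theta> - (\<theta> - s n *\<^sub>R ?one)) \<bullet> b) = (\<Prod>b\<in>(Basis :: (real ^ 'd) set). s n)"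
        by (intro prod.cong refl) (auto simp: Basis_vec_def inner_axis)
      moreover have "(\<theta> - s n *\<^sub>R ?one) \<bullet> b \<le> \<theta> \<bullet> b" if "b \<in> Basis" for b
        using that s(1)[of n] by (auto simp: Basis_vec_def inner_axis)
      ultimately show ?thesis
        unfolding Q_def by (subst emeasure_lborel_cbox) auto
    qed
    also have "ennreal (1 / ((C * real CARD('d)) * (s n)\<^sup>2) ^ \<nu>) * emeasure lborel (Q n) =
        (\<integral>\<^sup>+x. ennreal (1 / ((C * real CARD('d)) * (s n)\<^sup>2) ^ \<nu>) * indicator (Q n) x \<partial>lborel)"
      by (subst nn_integral_cmult_indicator) (auto simp: Q_def)
    also have "\<dots> \<le> (\<integral>\<^sup>+x. f x * indicator (Q n) x \<partial>lborel)"
    proof (intro nn_integral_mono)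
      fix x
      show "ennreal (1 / ((C * real CARD('d)) * (s n)\<^sup>2) ^ \<nu>) * indicator (Q n) x \<le> f x * indicator (Q n) x"
      proof (cases "x \<in> Q n")
        case True
        then have x: "\<theta> $ j - s n \<le> x $ j" "x $ j \<le> \<theta> $ j" for j
          by (auto simp: Q_def mem_box_cart)
        have "(norm (x - \<theta>))\<^sup>2 = (\<Sum>j\<in>UNIV. (x $ j - \<theta> $ j)\<^sup>2)"
          by (simp add: norm_vec_def L2_set_def sum_nonneg)
        also have "\<dots> \<le> (\<Sum>j\<in>(UNIV :: 'd set). (s n)\<^sup>2)"
        proof (rule sum_mono)
          fix j show "(x $ j - \<theta> $ j)\<^sup>2 \<le> (s n)\<^sup>2"
            using x[of j] by (intro power2_le_iff_abs_le[THEN iffD2]) auto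
        qed
        finally have "C * (norm (x - \<theta>))\<^sup>2 \<le> C * real CARD('d) * (s n)\<^sup>2"
          using C(1) by simp
        then have le: "trig_val \<Lambda> p x \<le> C * real CARD('d) * (s n)\<^sup>2"
          using C(2)[of "x - \<theta>"] by simp
        have pos: "0 < C * real CARD('d) * (s n)\<^sup>2"
          using C(1) s(1)[of n] by simp
        have "ennreal (1 / ((C * real CARD('d)) * (s n)\<^sup>2) ^ \<nu>) =
            1 / ennreal (C * real CARD('d) * (s n)\<^sup>2) ^ \<nu>"
          using pos by (simp add: ennreal_power divide_ennreal flip: ennreal_1)
        also have "\<dots> \<le> 1 / ennreal (trig_val \<Lambda> p x) ^ \<nu>"
          using le unfolding divide_ennreal_def mult_1_left
          by (intro inverse_ennreal_antimono power_mono ennreal_leI) auto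
        finally show ?thesis
          using True Qtorus[of n] by (auto simp: f_def)
      qed simp
    qed
    also have "\<dots> = emeasure M (Q n)"
      by (rule EM[symmetric]) (simp add: Q_def)
    finally show ?thesis .
  qed
  then have "ennreal K \<le> 0"
    using LIMSEQ_le_const[OF lim] by blast
  then show False using K by (simp add: ennreal_eq_0_iff)
qed

section \<open>Compactness\<close>

text \<open>Bolzano-Weierstrass on the finitely many coordinates in \<open>\<Lambda>\<close>; all
  other coordinates are constantly 0.\<close>

lemma coefficients_convergent_subsequence:
  fixes x :: "nat \<Rightarrow> 'k \<Rightarrow> real"
  assumes "finite \<Lambda>" "\<And>n k. k \<notin> \<Lambda> \<Longrightarrow> x n k = 0" "\<And>n k. \<bar>x n k\<bar> \<le> R"
  obtains r l where "strict_mono r" "\<And>k. (\<lambda>n. x (r n) k) \<longlonglongrightarrow> l k"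
proof -
  have "\<forall>D\<subseteq>\<Lambda>. \<exists>l :: 'k \<Rightarrow> real. \<exists>r :: nat \<Rightarrow> nat. strict_mono r \<and>
      (\<forall>e>0. eventually (\<lambda>n. \<forall>k\<in>D. dist (x (r n) k) (l k) < e) sequentially)"
    by (rule compact_lemma_general[where unproj = "\<lambda>f. f"])
      (use assms(1,3) in \<open>auto simp: bounded_iff intro!: exI[of _ R]\<close>)
  then obtain l r where r: "strict_mono r"
    and l: "\<And>e. e > 0 \<Longrightarrow> eventually (\<lambda>n. \<forall>k\<in>\<Lambda>. dist (x (r n) k) (l k) < e) sequentially"
    by blast
  have "(\<lambda>n. x (r n) k) \<longlonglongrightarrow> (if k \<in> \<Lambda> then l k else 0)" for k
  proof (cases "k \<in> \<Lambda>")
    case True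
    show ?thesis
    proof (rule tendstoI)
      fix e :: real assume "0 < e"
      from l[OF this] show "eventually (\<lambda>n. dist (x (r n) k) (if k \<in> \<Lambda> then l k else 0) < e) sequentially"
        by eventually_elim (use True in auto)
    qed
  qed (simp add: assms(2))
  with r show thesis by (rule that)
qed

lemma tendsto_trig_val:
  assumes "\<And>k. ((\<lambda>n. x n k) \<longlongrightarrow> l k) F"
  shows "((\<lambda>n. trig_val \<Lambda> (x n) \<theta>) \<longlongrightarrow> trig_val \<Lambda> l \<theta>) F"
  unfolding trig_val_sum by (intro tendsto_intros assms)

text \<open>For finite \<open>\<Lambda>\<close> containing 0 this is the closure of
  \<open>pos_polys \<Lambda>\<close>, by \<open>closure_pos_polys\<close>.\<close>

definition nonneg_polys :: "(int ^ 'd) set \<Rightarrow> (int ^ 'd \<Rightarrow> real) set" where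
  "nonneg_polys \<Lambda> = {q \<in> sym_coeffs \<Lambda>. \<forall>\<theta>\<in>torus. 0 \<le> trig_val \<Lambda> q \<theta>}"

lemma nonneg_polys_limit:
  assumes "\<And>n. x n \<in> nonneg_polys \<Lambda>" and lim: "\<And>k. (\<lambda>n. x n k) \<longlonglongrightarrow> l k"
  shows "l \<in> nonneg_polys \<Lambda>"
proof -
  have "l k = 0" if "k \<notin> \<Lambda>" for k
    using LIMSEQ_unique[OF lim[of k], of 0] assms(1) that by (simp add: nonneg_polys_def sym_coeffs_def)
  moreover have "l (- k) = l k" for k
    using LIMSEQ_unique[OF lim[of k], of "l (- k)"] lim[of "- k"] assms(1)
    by (simp add: nonneg_polys_def sym_coeffs_def)
  moreover have "0 \<le> trig_val \<Lambda> l \<theta>" if "\<theta> \<in> torus" for \<theta>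
    using assms(1) that
    by (intro LIMSEQ_le_const[OF tendsto_trig_val[where x = x, OF lim]]) (auto simp: nonneg_polys_def)
  ultimately show ?thesis by (auto simp: nonneg_polys_def sym_coeffs_def)
qed

text \<open>The slice of the cone with coefficient sum of absolute values 1 is compact.
  Counterexamples for constants tending to 0, rescaled to this slice, would have a nonzero limit in
  the cone on which the functional is at most 0.\<close>

lemma nonneg_polys_coercive:
  fixes \<Lambda> :: "(int ^ 'd) set" and c :: "int ^ 'd \<Rightarrow> real"
  assumes "finite \<Lambda>"
    and pos: "\<And>q. q \<in> nonneg_polys \<Lambda> \<Longrightarrow> q \<noteq> (\<lambda>_. 0) \<Longrightarrow> 0 < (\<Sum>k\<in>\<Lambda>. q k * c k)"
  obtains e where "0 < e" "\<And>q. q \<in> nonneg_polys \<Lambda> \<Longrightarrow> e * (\<Sum>k\<in>\<Lambda>. \<bar>q k\<bar>) \<le> (\<Sum>k\<in>\<Lambda>. q k * c k)"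
proof -
  have "\<exists>e>0. \<forall>q\<in>nonneg_polys \<Lambda>. e * (\<Sum>k\<in>\<Lambda>. \<bar>q k\<bar>) \<le> (\<Sum>k\<in>\<Lambda>. q k * c k)"
  proof (rule ccontr)
    assume "\<not> ?thesis"
    then have "\<exists>q\<in>nonneg_polys \<Lambda>. (\<Sum>k\<in>\<Lambda>. q k * c k) < e * (\<Sum>k\<in>\<Lambda>. \<bar>q k\<bar>)" if "0 < e" for e
      using that by (meson not_le)
    then have "\<forall>n. \<exists>q\<in>nonneg_polys \<Lambda>. (\<Sum>k\<in>\<Lambda>. q k * c k) < inverse (real (Suc n)) * (\<Sum>k\<in>\<Lambda>. \<bar>q k\<bar>)"
      by simp
    then obtain q where q: "\<And>n. q n \<in> nonneg_polys \<Lambda>"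
      "\<And>n. (\<Sum>k\<in>\<Lambda>. q n k * c k) < inverse (real (Suc n)) * (\<Sum>k\<in>\<Lambda>. \<bar>q n k\<bar>)"
      by metis
    define S where "S n = (\<Sum>k\<in>\<Lambda>. \<bar>q n k\<bar>)" for n
    define x where "x n k = q n k / S n" for n k
    \<comment> \<open>The strict inequality that defines \<open>q n\<close> fails for zero
      coefficients, so rescaling is possible.\<close>
    have S: "0 < S n" for n
    proof (rule ccontr)
      assume "\<not> 0 < S n"
      moreover have "0 \<le> S n" by (simp add: S_def sum_nonneg)
      ultimately have "S n = 0" by simp
      then have "\<forall>k\<in>\<Lambda>. q n k = 0"
        using assms(1) by (simp add: S_def sum_nonneg_eq_0_iff)
      then show False using q(2)[of n] by simp
    qed
    have x1: "(\<Sum>k\<in>\<Lambda>. \<bar>x n k\<bar>) = 1" for n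
      using S[of n] by (simp add: x_def abs_divide flip: sum_divide_distrib S_def)
    have xc: "x n \<in> nonneg_polys \<Lambda>" for n
    proof -
      have "trig_val \<Lambda> (x n) \<theta> = trig_val \<Lambda> (q n) \<theta> / S n" for \<theta>
        by (simp add: trig_val_sum x_def sum_divide_distrib)
      then show ?thesis
        using q(1)[of n] S[of n] by (auto simp: nonneg_polys_def sym_coeffs_def x_def)
    qed
    have x0: "x n k = 0" if "k \<notin> \<Lambda>" for n k
      using xc[of n] that by (auto simp: nonneg_polys_def sym_coeffs_def)
    have "\<bar>x n k\<bar> \<le> 1" for n k
    proof (cases "k \<in> \<Lambda>")
      case True
      then show ?thesis
        using member_le_sum[of k \<Lambda> "\<lambda>k. \<bar>x n k\<bar>"] assms(1) x1[of n] by simp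
    qed (simp add: x0)
    then obtain r l where r: "strict_mono r" and l: "\<And>k. (\<lambda>n. x (r n) k) \<longlonglongrightarrow> l k"
      using coefficients_convergent_subsequence[where x = x and R = 1, OF assms(1) x0] by blast
    have "l \<in> nonneg_polys \<Lambda>"
      by (rule nonneg_polys_limit[where x = "\<lambda>n. x (r n)"]) (rule xc l)+
    moreover have "(\<Sum>k\<in>\<Lambda>. \<bar>l k\<bar>) = 1"
    proof -
      have "(\<lambda>n. \<Sum>k\<in>\<Lambda>. \<bar>x (r n) k\<bar>) \<longlonglongrightarrow> (\<Sum>k\<in>\<Lambda>. \<bar>l k\<bar>)"
        by (intro tendsto_intros l)
      then show ?thesis by (simp add: x1 LIMSEQ_const_iff)
    qed
    then have "l \<noteq> (\<lambda>_. 0)" by auto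
    ultimately have "0 < (\<Sum>k\<in>\<Lambda>. l k * c k)" by (rule pos)
    moreover have "(\<Sum>k\<in>\<Lambda>. l k * c k) \<le> 0"
    proof (rule LIMSEQ_le)
      show "(\<lambda>n. \<Sum>k\<in>\<Lambda>. x (r n) k * c k) \<longlonglongrightarrow> (\<Sum>k\<in>\<Lambda>. l k * c k)"
        by (intro tendsto_intros l)
      show "(\<lambda>n. inverse (real (Suc (r n)))) \<longlonglongrightarrow> 0"
        using LIMSEQ_subseq_LIMSEQ[OF LIMSEQ_inverse_real_of_nat r] by (simp add: o_def)
      have "(\<Sum>k\<in>\<Lambda>. x n k * c k) \<le> inverse (real (Suc n))" for n
      proof -
        have "(\<Sum>k\<in>\<Lambda>. x n k * c k) = (\<Sum>k\<in>\<Lambda>. q n k * c k) / S n"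
          by (simp add: x_def sum_divide_distrib)
        also have "\<dots> \<le> inverse (real (Suc n))"
          using q(2)[of n] S[of n] by (simp add: pos_divide_le_eq S_def less_imp_le)
        finally show ?thesis .
      qed
      then show "\<exists>N. \<forall>n\<ge>N. (\<Sum>k\<in>\<Lambda>. x (r n) k * c k) \<le> inverse (real (Suc (r n)))" by blast
    qed
    ultimately show False by simp
  qed
  then show thesis using that by blast
qed

text \<open>Along a line in a generic direction the frequencies are distinct, so \<open>p\<^sub>0 \<plusminus> p\<^sub>k\<close> is the mean
  of the nonnegative function \<open>P(t v) (1 \<plusminus> cos (\<langle>k, v\<rangle> t))\<close>; \<open>F\<close> is its antiderivative.\<close>

lemma nonneg_polys_coeff_le:
  fixes \<Lambda> :: "(int ^ 'd) set"
  assumes "finite \<Lambda>" "0 \<in> \<Lambda>" "uminus ` \<Lambda> = \<Lambda>" "p \<in> nonneg_polys \<Lambda>" "k \<in> \<Lambda>" "k \<noteq> 0"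
  shows "\<bar>p k\<bar> \<le> p 0"
proof -
  obtain v where v: "inj_on (\<lambda>k. pairing k v) \<Lambda>"
    using exists_separating_direction[OF assms(1)] .
  define w where "w j = pairing j v" for j
  \<comment> \<open>\<open>S u T\<close> is the integral of cos (u t) over [0, T]. Divided by T it
    tends to 1 for u = 0 and to 0 otherwise.\<close>
  define S where "S u T = (if u = 0 then T else sin (u * T) / u)" for u T :: real
  have S0: "S u 0 = 0" for u by (simp add: S_def)
  have S_deriv: "(S u has_real_derivative cos (u * T)) (at T)" for u T
    unfolding S_def by (cases "u = 0") (auto intro!: derivative_eq_intros)
  have S_lim: "((\<lambda>T. S u T / T) \<longlongrightarrow> of_bool (u = 0)) at_top" for u
  proof (cases "u = 0")
    case True
    have "((\<lambda>T :: real. T / T) \<longlongrightarrow> 1) at_top" by real_asymp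
    then show ?thesis using True by (simp add: S_def)
  next
    case False
    have "((\<lambda>T. S u T / T) \<longlongrightarrow> 0) at_top"
    proof (rule Lim_null_comparison)
      show "eventually (\<lambda>T. norm (S u T / T) \<le> (1 / \<bar>u\<bar>) / T) at_top"
        using eventually_gt_at_top[of 0]
        by eventually_elim (use False in \<open>auto simp: S_def abs_divide abs_mult divide_simps\<close>)
      show "((\<lambda>T. (1 / \<bar>u\<bar>) / T) \<longlongrightarrow> 0) at_top"
        by (intro tendsto_divide_0[OF tendsto_const] filterlim_at_top_imp_at_infinity filterlim_ident)
    qed
    then show ?thesis using False by simp
  qed
  have mk: "- k \<in> \<Lambda>" using assms(3,5) by blast
  have inj: "w j = w l \<longleftrightarrow> j = l" if "j \<in> \<Lambda>" "l \<in> \<Lambda>" for j l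
    using v that by (auto simp: w_def inj_on_def)
  have w0: "w 0 = 0" by (simp add: w_def)
  have wk: "w (- k) = - w k" by (simp add: w_def pairing_uminus)
  \<comment> \<open>The signs \<sigma> = 1 and \<sigma> = -1 give the two halves of the
    bound.\<close>
  have "0 \<le> p 0 + \<sigma> * p k" if \<sigma>: "\<bar>\<sigma>\<bar> = 1" for \<sigma>
  proof -
    define F where "F T = (\<Sum>j\<in>\<Lambda>. p j * (S (w j) T + \<sigma> / 2 * (S (w j - w k) T + S (w j + w k) T)))" for T
    have "F 0 \<le> F T" if "0 \<le> T" for T
    proof (rule DERIV_nonneg_imp_nondecreasing[OF that])
      fix t :: real
      have "(F has_real_derivative (\<Sum>j\<in>\<Lambda>. p j * (cos (w j * t) +
          \<sigma> / 2 * (cos ((w j - w k) * t) + cos ((w j + w k) * t))))) (at t)"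
        unfolding F_def by (intro DERIV_sum DERIV_cmult DERIV_add S_deriv)
      also have "(\<Sum>j\<in>\<Lambda>. p j * (cos (w j * t) +
          \<sigma> / 2 * (cos ((w j - w k) * t) + cos ((w j + w k) * t)))) =
          trig_val \<Lambda> p (t *\<^sub>R v) * (1 + \<sigma> * cos (w k * t))"
        unfolding trig_val_sum sum_distrib_right
      proof (intro sum.cong refl)
        fix j
        have "cos ((w j - w k) * t) + cos ((w j + w k) * t) = 2 * (cos (w j * t) * cos (w k * t))"
          by (simp add: left_diff_distrib distrib_right cos_add cos_diff)
        moreover have "pairing j (t *\<^sub>R v) = w j * t"
          by (simp add: pairing_scaleR w_def)
        ultimately show "p j * (cos (w j * t) + \<sigma> / 2 * (cos ((w j - w k) * t) + cos ((w j + w k) * t))) =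
            p j * cos (pairing j (t *\<^sub>R v)) * (1 + \<sigma> * cos (w k * t))"
          by (simp add: distrib_left)
      qed
      finally have "(F has_real_derivative trig_val \<Lambda> p (t *\<^sub>R v) * (1 + \<sigma> * cos (w k * t))) (at t)" .
      moreover have "\<bar>\<sigma> * cos (w k * t)\<bar> \<le> 1" using \<sigma> by (simp add: abs_mult)
      then have "0 \<le> 1 + \<sigma> * cos (w k * t)" by linarith
      then have "0 \<le> trig_val \<Lambda> p (t *\<^sub>R v) * (1 + \<sigma> * cos (w k * t))"
        using trig_val_nonneg[of \<Lambda> p] assms(4) by (simp add: nonneg_polys_def)
      ultimately show "\<exists>y. (F has_real_derivative y) (at t) \<and> 0 \<le> y" by blast
    qed
    moreover have "F 0 = 0" by (simp add: F_def S0)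
    ultimately have nonneg: "0 \<le> F T" if "0 \<le> T" for T using that by simp
    have "F T / T = (\<Sum>j\<in>\<Lambda>. p j * (S (w j) T / T + \<sigma> / 2 * (S (w j - w k) T / T + S (w j + w k) T / T)))" for T
      unfolding F_def sum_divide_distrib by (intro sum.cong refl, cases "T = 0") (simp_all add: field_simps)
    then have lim: "((\<lambda>T. F T / T) \<longlongrightarrow>
        (\<Sum>j\<in>\<Lambda>. p j * (of_bool (w j = 0) + \<sigma> / 2 * (of_bool (w j - w k = 0) + of_bool (w j + w k = 0))))) at_top"
      by (simp only:) (intro tendsto_sum tendsto_mult tendsto_add tendsto_const S_lim)
    \<comment> \<open>Only zero frequencies survive the mean: j = 0 contributes \<open>p 0\<close>,
      while j = k and j = - k contribute half of \<sigma> p_k each, by symmetry of the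
      coefficients.\<close>
    have "(\<Sum>j\<in>\<Lambda>. p j * (of_bool (w j = 0) + \<sigma> / 2 * (of_bool (w j - w k = 0) + of_bool (w j + w k = 0)))) =
        (\<Sum>j\<in>\<Lambda>. (if j = 0 then p j else 0) + (if j = k then \<sigma> / 2 * p j else 0) +
          (if j = - k then \<sigma> / 2 * p j else 0))"
    proof (intro sum.cong refl)
      fix j assume j: "j \<in> \<Lambda>"
      have "w j = 0 \<longleftrightarrow> j = 0" "w j - w k = 0 \<longleftrightarrow> j = k" "w j + w k = 0 \<longleftrightarrow> j = - k"
        using inj[OF j assms(2)] inj[OF j assms(5)] inj[OF j mk] w0 wk by auto
      then show "p j * (of_bool (w j = 0) + \<sigma> / 2 * (of_bool (w j - w k = 0) + of_bool (w j + w k = 0))) =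
          (if j = 0 then p j else 0) + (if j = k then \<sigma> / 2 * p j else 0) + (if j = - k then \<sigma> / 2 * p j else 0)"
        using assms(4) by (simp add: of_bool_def distrib_left nonneg_polys_def sym_coeffs_def)
    qed
    also have "\<dots> = p 0 + \<sigma> / 2 * p k + \<sigma> / 2 * p (- k)"
      using assms(1,2,5) mk by (simp add: sum.distrib)
    also have "\<dots> = p 0 + \<sigma> * p k"
      using assms(4) by (simp add: nonneg_polys_def sym_coeffs_def)
    finally have "((\<lambda>T. F T / T) \<longlongrightarrow> p 0 + \<sigma> * p k) at_top"
      using lim by (simp only:)
    moreover have "eventually (\<lambda>T. 0 \<le> F T / T) at_top"
      using eventually_ge_at_top[of 0] by eventually_elim (simp add: nonneg)
    ultimately show ?thesis
      by (intro tendsto_lowerbound) auto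
  qed
  from this[of 1] this[of "-1"] show ?thesis by simp
qed

section \<open>Moments\<close>

lemma integrable_moment:
  fixes f :: "real ^ 'd \<Rightarrow> real"
  assumes "integrable torus_measure f"
  shows "integrable torus_measure (\<lambda>\<theta>. exp (\<i> * of_real (pairing k \<theta>)) * of_real (f \<theta>) :: complex)"
proof (rule Bochner_Integration.integrable_bound[OF assms])
  have "(\<lambda>\<theta>. exp (\<i> * of_real (pairing k \<theta>)) :: complex) \<in> borel_measurable borel"
    by (intro borel_measurable_continuous_onI continuous_intros)
  from measurable_torus_measure[OF this] borel_measurable_integrable[OF assms]
  show "(\<lambda>\<theta>. exp (\<i> * of_real (pairing k \<theta>)) * of_real (f \<theta>) :: complex) \<in> borel_measurable torus_measure"
    by measurable
qed (simp add: norm_mult)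

lemma Re_moment:
  assumes "integrable torus_measure f"
  shows "Re (moment f k) = (LINT \<theta>|torus_measure. cos (pairing k \<theta>) * f \<theta>)"
  unfolding moment_def integral_Re[OF integrable_moment[OF assms], symmetric]
  by (simp add: Re_exp)

lemma Im_moment:
  assumes "integrable torus_measure f"
  shows "Im (moment f k) = (LINT \<theta>|torus_measure. sin (pairing k \<theta>) * f \<theta>)"
  unfolding moment_def integral_Im[OF integrable_moment[OF assms], symmetric]
  by (simp add: Im_exp)

lemma integrable_cos_mult:
  fixes f :: "real ^ 'd \<Rightarrow> real"
  assumes "integrable torus_measure f"
  shows "integrable torus_measure (\<lambda>\<theta>. cos (pairing k \<theta>) * f \<theta>)"
  using integrable_Re[OF integrable_moment[OF assms, of k]] by (simp add: Re_exp)

text \<open>The passage between coefficients and integrals: it represents the linear form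
  \<langle>c, q\<rangle> as an integral and later reads moments off the stationarity
  condition.\<close>

lemma integral_trig_val_mult:
  fixes f :: "real ^ 'd \<Rightarrow> real"
  assumes "integrable torus_measure f"
  shows "integrable torus_measure (\<lambda>\<theta>. trig_val \<Lambda> q \<theta> * f \<theta>)"
    and "(LINT \<theta>|torus_measure. trig_val \<Lambda> q \<theta> * f \<theta>) = (\<Sum>k\<in>\<Lambda>. q k * Re (moment f k))"
proof -
  have eq: "trig_val \<Lambda> q \<theta> * f \<theta> = (\<Sum>k\<in>\<Lambda>. q k * (cos (pairing k \<theta>) * f \<theta>))" for \<theta>
    by (simp add: trig_val_sum sum_distrib_right mult.assoc)
  show "integrable torus_measure (\<lambda>\<theta>. trig_val \<Lambda> q \<theta> * f \<theta>)"
    unfolding eq by (intro Bochner_Integration.integrable_sum integrable_mult_right integrable_cos_mult assms)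
  show "(LINT \<theta>|torus_measure. trig_val \<Lambda> q \<theta> * f \<theta>) = (\<Sum>k\<in>\<Lambda>. q k * Re (moment f k))"
    unfolding eq Re_moment[OF assms]
    by (subst Bochner_Integration.integral_sum)
      (auto intro!: integrable_mult_right integrable_cos_mult assms)
qed

text \<open>The sum is the integral of Q times the feasible density. If it were 0, Q would vanish
  almost everywhere on the ball where the density is positive, hence be the zero polynomial.\<close>

lemma feasible_moments_positive:
  fixes \<Phi> :: "real ^ 'd \<Rightarrow> real"
  assumes "finite \<Lambda>" "uminus ` \<Lambda> = \<Lambda>"
    and \<Phi>: "integrable torus_measure \<Phi>" "\<And>\<theta>. \<theta> \<in> torus \<Longrightarrow> 0 \<le> \<Phi> \<theta>"
    and ball: "0 < r" "ball x r \<subseteq> torus" "\<And>\<theta>. \<theta> \<in> ball x r \<Longrightarrow> 0 < \<Phi> \<theta>"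
    and c: "\<And>k. k \<in> \<Lambda> \<Longrightarrow> complex_of_real (c k) = moment \<Phi> k"
    and q: "q \<in> nonneg_polys \<Lambda>" "q \<noteq> (\<lambda>_. 0)"
  shows "0 < (\<Sum>k\<in>\<Lambda>. q k * c k)"
proof -
  have "(\<Sum>k\<in>\<Lambda>. q k * c k) = (\<Sum>k\<in>\<Lambda>. q k * Re (moment \<Phi> k))"
    using c by (intro sum.cong refl) (metis Re_complex_of_real)
  also have "\<dots> = (LINT \<theta>|torus_measure. trig_val \<Lambda> q \<theta> * \<Phi> \<theta>)"
    by (rule integral_trig_val_mult(2)[OF \<Phi>(1), symmetric])
  finally have eq: "(\<Sum>k\<in>\<Lambda>. q k * c k) = (LINT \<theta>|torus_measure. trig_val \<Lambda> q \<theta> * \<Phi> \<theta>)" .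
  have nn: "AE \<theta> in torus_measure. 0 \<le> trig_val \<Lambda> q \<theta> * \<Phi> \<theta>"
    using AE_torus_measure_torus by eventually_elim (use q(1) \<Phi>(2) in \<open>auto simp: nonneg_polys_def\<close>)
  have "(LINT \<theta>|torus_measure. trig_val \<Lambda> q \<theta> * \<Phi> \<theta>) \<noteq> 0"
  proof
    assume "(LINT \<theta>|torus_measure. trig_val \<Lambda> q \<theta> * \<Phi> \<theta>) = 0"
    then have "AE \<theta> in torus_measure. trig_val \<Lambda> q \<theta> * \<Phi> \<theta> = 0"
      using integral_nonneg_eq_0_iff_AE[OF integral_trig_val_mult(1)[OF \<Phi>(1)] nn] by simp
    then have "AE \<theta> in torus_measure. \<theta> \<in> ball x r \<longrightarrow> trig_val \<Lambda> q \<theta> = 0"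
      by eventually_elim (use ball(3) in force)
    then show False
      using trig_val_AE_zero_imp[OF assms(1,2) _ _ ball(1,2)] q by (auto simp: nonneg_polys_def)
  qed
  moreover have "0 \<le> (LINT \<theta>|torus_measure. trig_val \<Lambda> q \<theta> * \<Phi> \<theta>)"
    using nn by (rule integral_nonneg_AE)
  ultimately show ?thesis unfolding eq by simp
qed

section \<open>The regularized dual function\<close>

lemma not_AE_torus_measure_False: "\<not> (AE \<theta> in (torus_measure :: (real ^ 'd) measure). False)"
proof
  assume *: "AE \<theta> in (torus_measure :: (real ^ 'd) measure). False"
  have "ball (\<chi> j. pi) 1 \<subseteq> (torus :: (real ^ 'd) set)"
  proof
    fix x :: "real ^ 'd" assume "x \<in> ball (\<chi> j. pi) 1"
    then have "\<bar>pi - x $ j\<bar> < 1" for j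
      using component_le_norm_cart[of "(\<chi> j. pi) - x" j] by (simp add: dist_norm)
    then have "0 < x $ j \<and> x $ j \<le> 2 * pi" for j
      using pi_gt3 by (smt (verit, best))
    then show "x \<in> torus" by (simp add: torus_def)
  qed
  moreover have "AE \<theta> in torus_measure. \<theta> \<notin> ball (\<chi> j. pi :: real ^ 'd) 1"
    using * by eventually_elim simp
  ultimately show False
    using not_AE_torus_measure_outside_ball[of 1 "\<chi> j. pi :: real ^ 'd"] by simp
qed

lemma tendsto_inverse_ennreal: "(f \<longlongrightarrow> l) F \<Longrightarrow> ((\<lambda>x. inverse (f x)) \<longlongrightarrow> inverse (l :: ennreal)) F"
  using continuous_on_tendsto_compose[of UNIV inverse f l F] continuous_on_inverse_ennreal[of UNIV "\<lambda>x. x"]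
  by simp

text \<open>Feasibility enters as \<open>c_pos\<close>, the strict positivity that
  \<open>feasible_moments_positive\<close> provides; \<open>dim\<close> is the bound \<nu> \<ge> d/2
  in natural numbers.\<close>

locale dual_problem =
  fixes \<nu> :: nat and lam :: real and \<Lambda> :: "(int ^ 'd) set" and c m :: "int ^ 'd \<Rightarrow> real"
  assumes nu: "2 \<le> \<nu>" and lam: "0 < lam"
    and fin: "finite \<Lambda>" and zero: "0 \<in> \<Lambda>" and sym: "uminus ` \<Lambda> = \<Lambda>"
    and c_pos: "\<And>q. q \<in> nonneg_polys \<Lambda> \<Longrightarrow> q \<noteq> (\<lambda>_. 0) \<Longrightarrow> 0 < (\<Sum>k\<in>\<Lambda>. q k * c k)"
    and dim: "CARD('d) \<le> 2 * \<nu>"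
begin

definition \<alpha> :: real where "\<alpha> = 1 / (real \<nu> - 1)"

definition \<beta> :: real where "\<beta> = lam / (real \<nu> - 1)"

lemma \<alpha>_pos: "0 < \<alpha>" and \<beta>_pos: "0 < \<beta>"
  using nu lam by (auto simp: \<alpha>_def \<beta>_def)

text \<open>Division in \<open>ennreal\<close> sends a / 0 to infinity for a > 0, so for x > 0 the
  integrand extends continuously to y = 0 and no zero set has to be removed.\<close>

definition integrand :: "real \<Rightarrow> real \<Rightarrow> ennreal" where
  "integrand x y = ennreal \<alpha> * (ennreal x ^ \<nu> / ennreal y ^ (\<nu> - 1)) + ennreal \<beta> * (1 / ennreal x ^ \<nu>)"

definition energy :: "(int ^ 'd \<Rightarrow> real) \<Rightarrow> (int ^ 'd \<Rightarrow> real) \<Rightarrow> ennreal" where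
  "energy p q = (\<integral>\<^sup>+\<theta>. integrand (trig_val \<Lambda> p \<theta>) (trig_val \<Lambda> q \<theta>) \<partial>torus_measure)"

definition linear_part :: "(int ^ 'd \<Rightarrow> real) \<Rightarrow> (int ^ 'd \<Rightarrow> real) \<Rightarrow> real" where
  "linear_part p q = (\<Sum>k\<in>\<Lambda>. q k * c k) - (\<Sum>k\<in>\<Lambda> - {0}. p k * m k)"

definition dual :: "(int ^ 'd \<Rightarrow> real) \<Rightarrow> (int ^ 'd \<Rightarrow> real) \<Rightarrow> ereal" where
  "dual p q = enn2ereal (energy p q) + ereal (linear_part p q)"

text \<open>The closure of \<open>pos_polys_norm \<Lambda>\<close>, by
  \<open>closure_pos_polys_norm\<close>.\<close>

definition norm_polys :: "(int ^ 'd \<Rightarrow> real) set" where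
  "norm_polys = {p \<in> nonneg_polys \<Lambda>. p 0 = 1}"

lemma norm_polys_nonneg: "p \<in> norm_polys \<Longrightarrow> p \<in> nonneg_polys \<Lambda>"
  by (simp add: norm_polys_def)

lemma norm_polys_nonzero: "p \<in> norm_polys \<Longrightarrow> p \<noteq> (\<lambda>_. 0)"
  by (auto simp: norm_polys_def)

lemma measurable_integrand [measurable]:
  assumes [measurable]: "f \<in> borel_measurable M" "g \<in> borel_measurable M"
  shows "(\<lambda>x. integrand (f x) (g x)) \<in> borel_measurable M"
  unfolding integrand_def by measurable

lemma AE_trig_val_pos:
  assumes "q \<in> nonneg_polys \<Lambda>" "q \<noteq> (\<lambda>_. 0)"
  shows "AE \<theta> in torus_measure. 0 < trig_val \<Lambda> q \<theta>"
proof -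
  have "AE \<theta> in torus_measure. trig_val \<Lambda> q \<theta> \<noteq> 0"
    using AE_trig_val_nonzero[OF fin sym] assms by (simp add: nonneg_polys_def)
  then show ?thesis
    using AE_torus_measure_torus
    by eventually_elim (use assms(1) in \<open>auto simp: nonneg_polys_def less_le\<close>)
qed

lemma integrand_at_0: "0 < x \<Longrightarrow> integrand x 0 = \<infinity>"
  using nu \<alpha>_pos by (simp add: integrand_def power_0_left ennreal_mult_top)

text \<open>P is positive almost everywhere, so the integrand at Q = 0 is infinite there. The value
  prescribed by \<open>dual_fun\<close> at the zero polynomial is therefore the one that the formula
  produces.\<close>

lemma energy_zero_polynomial:
  assumes "p \<in> norm_polys"
  shows "energy p (\<lambda>_. 0) = \<infinity>"
proof (rule ccontr)
  assume "energy p (\<lambda>_. 0) \<noteq> \<infinity>"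
  then have "AE \<theta> in torus_measure. integrand (trig_val \<Lambda> p \<theta>) (trig_val \<Lambda> (\<lambda>_. 0) \<theta>) \<noteq> \<infinity>"
    unfolding energy_def
    by (intro nn_integral_PInf_AE measurable_integrand measurable_torus_measure measurable_trig_val)
  then have "AE \<theta> in (torus_measure :: (real ^ 'd) measure). False"
    using AE_trig_val_pos[OF norm_polys_nonneg[OF assms] norm_polys_nonzero[OF assms]]
    by eventually_elim (simp add: trig_val_sum[of _ "\<lambda>_. 0"] integrand_at_0)
  then show False using not_AE_torus_measure_False by blast
qed

text \<open>For nonzero Q the sets cut out of the two integrals are null. For Q = 0 both sides are
  infinite.\<close>

lemma dual_fun_eq_dual:
  assumes p: "p \<in> norm_polys" and q: "q \<in> nonneg_polys \<Lambda>"
  shows "dual_fun \<nu> lam \<Lambda> c m p q = dual p q"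
proof (cases "q = (\<lambda>_. 0)")
  case True
  then show ?thesis
    using energy_zero_polynomial[OF p] by (simp add: dual_fun_def dual_def)
next
  case False
  let ?P = "trig_val \<Lambda> p" and ?Q = "trig_val \<Lambda> q"
  let ?X = "\<integral>\<^sup>+\<theta>\<in>{\<theta>. ?P \<theta> \<noteq> 0 \<and> ?Q \<theta> \<noteq> 0}. ennreal (?P \<theta> ^ \<nu> / ?Q \<theta> ^ (\<nu> - 1)) \<partial>torus_measure"
  let ?Y = "\<integral>\<^sup>+\<theta>\<in>{\<theta>. ?P \<theta> \<noteq> 0}. ennreal (1 / ?P \<theta> ^ \<nu>) \<partial>torus_measure"
  note pos = AE_trig_val_pos[OF norm_polys_nonneg[OF p] norm_polys_nonzero[OF p]]
    AE_trig_val_pos[OF q False]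
  have m: "?P \<in> borel_measurable torus_measure" "?Q \<in> borel_measurable torus_measure"
    by (intro measurable_torus_measure measurable_trig_val)+
  note [measurable] = m
  have "energy p q = (\<integral>\<^sup>+\<theta>. ennreal \<alpha> * (ennreal (?P \<theta> ^ \<nu> / ?Q \<theta> ^ (\<nu> - 1)) * indicator {\<theta>. ?P \<theta> \<noteq> 0 \<and> ?Q \<theta> \<noteq> 0} \<theta>) +
      ennreal \<beta> * (ennreal (1 / ?P \<theta> ^ \<nu>) * indicator {\<theta>. ?P \<theta> \<noteq> 0} \<theta>) \<partial>torus_measure)"
    unfolding energy_def
  proof (intro nn_integral_cong_AE)
    show "AE \<theta> in torus_measure. integrand (?P \<theta>) (?Q \<theta>) =
        ennreal \<alpha> * (ennreal (?P \<theta> ^ \<nu> / ?Q \<theta> ^ (\<nu> - 1)) * indicator {\<theta>. ?P \<theta> \<noteq> 0 \<and> ?Q \<theta> \<noteq> 0} \<theta>) +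
        ennreal \<beta> * (ennreal (1 / ?P \<theta> ^ \<nu>) * indicator {\<theta>. ?P \<theta> \<noteq> 0} \<theta>)"
      using pos
    proof eventually_elim
      fix \<theta> assume "0 < ?P \<theta>" "0 < ?Q \<theta>"
      moreover from this have "ennreal (?P \<theta>) ^ \<nu> / ennreal (?Q \<theta>) ^ (\<nu> - 1) = ennreal (?P \<theta> ^ \<nu> / ?Q \<theta> ^ (\<nu> - 1))"
        "1 / ennreal (?P \<theta>) ^ \<nu> = ennreal (1 / ?P \<theta> ^ \<nu>)"
        by (simp_all add: ennreal_power divide_ennreal flip: ennreal_1)
      ultimately show "integrand (?P \<theta>) (?Q \<theta>) =
          ennreal \<alpha> * (ennreal (?P \<theta> ^ \<nu> / ?Q \<theta> ^ (\<nu> - 1)) * indicator {\<theta>. ?P \<theta> \<noteq> 0 \<and> ?Q \<theta> \<noteq> 0} \<theta>) +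
          ennreal \<beta> * (ennreal (1 / ?P \<theta> ^ \<nu>) * indicator {\<theta>. ?P \<theta> \<noteq> 0} \<theta>)"
        by (simp add: integrand_def)
    qed
  qed
  also have "\<dots> = ennreal \<alpha> * ?X + ennreal \<beta> * ?Y"
  proof -
    have X: "(\<lambda>\<theta>. ennreal (?P \<theta> ^ \<nu> / ?Q \<theta> ^ (\<nu> - 1)) * indicator {\<theta>. ?P \<theta> \<noteq> 0 \<and> ?Q \<theta> \<noteq> 0} \<theta>) \<in> borel_measurable torus_measure"
      by (intro measurable_torus_measure) measurable
    have Y: "(\<lambda>\<theta>. ennreal (1 / ?P \<theta> ^ \<nu>) * indicator {\<theta>. ?P \<theta> \<noteq> 0} \<theta>) \<in> borel_measurable torus_measure"
      by (intro measurable_torus_measure) measurable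
    show ?thesis
      using X Y by (simp add: nn_integral_add nn_integral_cmult)
  qed
  finally have "enn2ereal (energy p q) = ereal \<alpha> * enn2ereal ?X + ereal \<beta> * enn2ereal ?Y"
    using \<alpha>_pos \<beta>_pos by (simp add: plus_ennreal.rep_eq times_ennreal.rep_eq)
  moreover have "0 \<le> ereal \<alpha> * enn2ereal ?X" "0 \<le> ereal \<beta> * enn2ereal ?Y"
    using \<alpha>_pos \<beta>_pos by simp_all
  \<comment> \<open>Regrouping in \<open>ereal\<close> is safe because both integral terms are
    nonnegative.\<close>
  moreover have "x + ereal s - ereal t + y = (x + y) + ereal (s - t)" if "0 \<le> x" "0 \<le> y" for x y s t
    using that by (cases x; cases y) auto
  ultimately show ?thesis
    using False by (simp add: dual_fun_def dual_def linear_part_def flip: \<alpha>_def \<beta>_def)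
qed

section \<open>Lower bounds, semicontinuity and existence of a minimizer\<close>

lemma norm_polys_coeff_le: "p \<in> norm_polys \<Longrightarrow> \<bar>p k\<bar> \<le> 1"
  using nonneg_polys_coeff_le[OF fin zero sym, of p k]
  by (cases "k = 0"; cases "k \<in> \<Lambda>") (auto simp: norm_polys_def nonneg_polys_def sym_coeffs_def)

text \<open>Coercivity controls the part in q; the part in p is bounded because |p_k| \<le>
  1.\<close>

lemma linear_part_ge:
  obtains e C where "0 < e"
    "\<And>p q. p \<in> norm_polys \<Longrightarrow> q \<in> nonneg_polys \<Lambda> \<Longrightarrow> e * (\<Sum>k\<in>\<Lambda>. \<bar>q k\<bar>) - C \<le> linear_part p q"
proof -
  obtain e where e: "0 < e" "\<And>q. q \<in> nonneg_polys \<Lambda> \<Longrightarrow> e * (\<Sum>k\<in>\<Lambda>. \<bar>q k\<bar>) \<le> (\<Sum>k\<in>\<Lambda>. q k * c k)"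
    using nonneg_polys_coercive[OF fin c_pos] by blast
  have "(\<Sum>k\<in>\<Lambda> - {0}. p k * m k) \<le> (\<Sum>k\<in>\<Lambda> - {0}. \<bar>m k\<bar>)" if "p \<in> norm_polys" for p
  proof (rule sum_mono)
    fix k
    have "p k * m k \<le> \<bar>p k\<bar> * \<bar>m k\<bar>"
      by (metis abs_ge_self abs_mult)
    also have "\<dots> \<le> 1 * \<bar>m k\<bar>"
      using norm_polys_coeff_le[OF that] by (intro mult_right_mono) auto
    finally show "p k * m k \<le> \<bar>m k\<bar>" by simp
  qed
  then have "e * (\<Sum>k\<in>\<Lambda>. \<bar>q k\<bar>) - (\<Sum>k\<in>\<Lambda> - {0}. \<bar>m k\<bar>) \<le> linear_part p q"
    if "p \<in> norm_polys" "q \<in> nonneg_polys \<Lambda>" for p q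
    using e(2)[of q] that unfolding linear_part_def by (simp add: diff_mono)
  with e(1) show thesis by (rule that)
qed

definition one :: "int ^ 'd \<Rightarrow> real" where "one = (\<lambda>k. if k = 0 then 1 else 0)"

lemma trig_val_one [simp]: "trig_val \<Lambda> one \<theta> = 1"
  unfolding one_def using const_one_poly(2)[OF fin zero] .

lemma one_sym: "one \<in> sym_coeffs \<Lambda>"
  unfolding one_def using const_one_poly(1)[OF fin zero] .

lemma one_norm_polys: "one \<in> norm_polys"
  using one_sym by (simp add: norm_polys_def nonneg_polys_def) (simp add: one_def)

lemma dual_one_finite: "dual one one < \<infinity>"
proof -
  have "energy one one < \<infinity>"
    using finite_measure.emeasure_finite[OF finite_measure_torus[where 'd = 'd], of "space torus_measure"]
    by (simp add: energy_def integrand_def ennreal_mult_less_top less_top)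
  then show ?thesis
    by (simp add: dual_def less_top[symmetric])
qed

text \<open>The operations in \<open>integrand\<close> are continuous on \<open>ennreal\<close>
  except at 0 times infinity, which P' > 0 excludes almost everywhere. So the integrands converge
  even at zeros of Q', and Fatou applies.\<close>

lemma energy_lsc:
  assumes p: "\<And>n. p n \<in> norm_polys" "p' \<in> norm_polys" "\<And>k. (\<lambda>n. p n k) \<longlonglongrightarrow> p' k"
    and q: "\<And>n. q n \<in> nonneg_polys \<Lambda>" "\<And>k. (\<lambda>n. q n k) \<longlonglongrightarrow> q' k"
  shows "energy p' q' \<le> liminf (\<lambda>n. energy (p n) (q n))"
proof -
  have "energy p' q' = (\<integral>\<^sup>+\<theta>. liminf (\<lambda>n. integrand (trig_val \<Lambda> (p n) \<theta>) (trig_val \<Lambda> (q n) \<theta>)) \<partial>torus_measure)"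
    unfolding energy_def
  proof (rule nn_integral_cong_AE)
    show "AE \<theta> in torus_measure. integrand (trig_val \<Lambda> p' \<theta>) (trig_val \<Lambda> q' \<theta>) =
        liminf (\<lambda>n. integrand (trig_val \<Lambda> (p n) \<theta>) (trig_val \<Lambda> (q n) \<theta>))"
      using AE_torus_measure_torus AE_trig_val_pos[OF norm_polys_nonneg[OF p(2)] norm_polys_nonzero[OF p(2)]]
    proof eventually_elim
      fix \<theta> :: "real ^ 'd" assume \<theta>: "\<theta> \<in> torus" "0 < trig_val \<Lambda> p' \<theta>"
      let ?x = "\<lambda>n. trig_val \<Lambda> (p n) \<theta>" and ?y = "\<lambda>n. trig_val \<Lambda> (q n) \<theta>"
      have nn: "0 \<le> ?x n" "0 \<le> ?y n" for n
        using p(1)[of n] q(1)[of n] \<theta>(1) by (auto simp: norm_polys_def nonneg_polys_def)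
      have lim: "?x \<longlonglongrightarrow> trig_val \<Lambda> p' \<theta>" "?y \<longlonglongrightarrow> trig_val \<Lambda> q' \<theta>"
        by (intro tendsto_trig_val p(3) q(2))+
      have q'0: "0 \<le> trig_val \<Lambda> q' \<theta>"
        using LIMSEQ_le_const[OF lim(2), of 0] nn(2) by blast
      have form: "integrand x y = ennreal \<alpha> * (ennreal (x ^ \<nu>) * inverse (ennreal (y ^ (\<nu> - 1)))) +
          ennreal \<beta> * inverse (ennreal (x ^ \<nu>))" if "0 \<le> x" "0 \<le> y" for x y
        using that by (simp add: integrand_def divide_ennreal_def ennreal_power)
      have "(\<lambda>n. ennreal \<alpha> * (ennreal (?x n ^ \<nu>) * inverse (ennreal (?y n ^ (\<nu> - 1)))) +
          ennreal \<beta> * inverse (ennreal (?x n ^ \<nu>))) \<longlonglongrightarrow>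
          ennreal \<alpha> * (ennreal (trig_val \<Lambda> p' \<theta> ^ \<nu>) * inverse (ennreal (trig_val \<Lambda> q' \<theta> ^ (\<nu> - 1)))) +
          ennreal \<beta> * inverse (ennreal (trig_val \<Lambda> p' \<theta> ^ \<nu>))"
        using \<theta>(2) \<alpha>_pos \<beta>_pos
        by (intro tendsto_add tendsto_mult_ennreal tendsto_const tendsto_inverse_ennreal tendsto_ennrealI
            tendsto_power lim) auto
      then have "(\<lambda>n. integrand (?x n) (?y n)) \<longlonglongrightarrow> integrand (trig_val \<Lambda> p' \<theta>) (trig_val \<Lambda> q' \<theta>)"
        using \<theta>(2) q'0 by (simp add: form nn)
      then show "integrand (trig_val \<Lambda> p' \<theta>) (trig_val \<Lambda> q' \<theta>) = liminf (\<lambda>n. integrand (?x n) (?y n))"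
        by (simp add: lim_imp_Liminf)
    qed
  qed
  also have "\<dots> \<le> liminf (\<lambda>n. energy (p n) (q n))"
    unfolding energy_def
    by (intro nn_integral_liminf measurable_integrand measurable_torus_measure measurable_trig_val)
  finally show ?thesis .
qed

lemma exists_minimizer:
  obtains p q where "p \<in> norm_polys" "q \<in> nonneg_polys \<Lambda>"
    "\<And>p' q'. p' \<in> norm_polys \<Longrightarrow> q' \<in> nonneg_polys \<Lambda> \<Longrightarrow> dual p q \<le> dual p' q'"
proof -
  define V where "V = (\<lambda>(p, q). dual p q) ` (norm_polys \<times> nonneg_polys \<Lambda>)"
  define \<mu> where "\<mu> = Inf V"
  have one_in: "dual one one \<in> V"
    using one_norm_polys norm_polys_nonneg by (force simp: V_def)
  obtain u where u: "\<And>n. u n \<in> V" "u \<longlonglongrightarrow> \<mu>"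
    using Inf_as_limit[of V] one_in unfolding \<mu>_def by blast
  obtain e C where eC: "0 < e"
    "\<And>p q. p \<in> norm_polys \<Longrightarrow> q \<in> nonneg_polys \<Lambda> \<Longrightarrow> e * (\<Sum>k\<in>\<Lambda>. \<bar>q k\<bar>) - C \<le> linear_part p q"
    using linear_part_ge by blast
  have dual_ge: "ereal (e * (\<Sum>k\<in>\<Lambda>. \<bar>q k\<bar>) - C) \<le> dual p q" if "p \<in> norm_polys" "q \<in> nonneg_polys \<Lambda>" for p q
    using eC(2)[OF that] add_mono[of 0 "enn2ereal (energy p q)" "ereal (e * (\<Sum>k\<in>\<Lambda>. \<bar>q k\<bar>) - C)" "ereal (linear_part p q)"]
    by (simp add: dual_def)
  have V_ge: "ereal (- C) \<le> v" if v: "v \<in> V" for v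
  proof -
    obtain p q where pq: "p \<in> norm_polys" "q \<in> nonneg_polys \<Lambda>" "v = dual p q"
      using v by (auto simp: V_def)
    have "ereal (- C) \<le> ereal (e * (\<Sum>k\<in>\<Lambda>. \<bar>q k\<bar>) - C)"
      using eC(1) by (simp add: sum_nonneg)
    then show ?thesis
      using dual_ge[OF pq(1,2)] pq(3) by (meson order_trans)
  qed
  have "\<mu> \<le> dual one one" unfolding \<mu>_def by (rule Inf_lower[OF one_in])
  then have "\<mu> < \<infinity>" using dual_one_finite by (rule le_less_trans)
  moreover have "ereal (- C) \<le> \<mu>" unfolding \<mu>_def by (rule Inf_greatest[OF V_ge])
  ultimately obtain \<mu>r where \<mu>r: "\<mu> = ereal \<mu>r" by (cases \<mu>) auto
  have "eventually (\<lambda>n. u n < ereal (\<mu>r + 1)) sequentially"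
    using order_tendstoD(2)[OF u(2), of "ereal (\<mu>r + 1)"] by (simp add: \<mu>r)
  \<comment> \<open>Values below \<mu>r + 1 make every energy finite and, by coercivity, bound the
    coefficients of \<open>q\<close>.\<close>
  then obtain N where N: "\<And>n. u (n + N) < ereal (\<mu>r + 1)"
    unfolding eventually_sequentially by (metis le_add2)
  have "\<forall>n. \<exists>p q. p \<in> norm_polys \<and> q \<in> nonneg_polys \<Lambda> \<and> u (n + N) = dual p q"
    using u(1) by (fastforce simp: V_def)
  then obtain p q where pq: "\<And>n. p n \<in> norm_polys" "\<And>n. q n \<in> nonneg_polys \<Lambda>" "\<And>n. u (n + N) = dual (p n) (q n)"
    by metis
  have dlim: "(\<lambda>n. dual (p n) (q n)) \<longlonglongrightarrow> ereal \<mu>r"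
    using LIMSEQ_ignore_initial_segment[OF u(2), of N] by (simp add: pq(3) \<mu>r)
  have p0: "p n k = 0" "q n k = 0" if "k \<notin> \<Lambda>" for n k
    using pq(1,2)[of n] that by (auto simp: norm_polys_def nonneg_polys_def sym_coeffs_def)
  have qb: "\<bar>q n k\<bar> \<le> (\<bar>\<mu>r + 1 + C\<bar>) / e" for n k
  proof (cases "k \<in> \<Lambda>")
    case True
    have "ereal (e * (\<Sum>k\<in>\<Lambda>. \<bar>q n k\<bar>) - C) < ereal (\<mu>r + 1)"
      using dual_ge[OF pq(1,2)[of n]] N[of n] pq(3)[of n] by (metis le_less_trans)
    then have "e * (\<Sum>k\<in>\<Lambda>. \<bar>q n k\<bar>) \<le> \<bar>\<mu>r + 1 + C\<bar>" by simp
    moreover have "e * \<bar>q n k\<bar> \<le> e * (\<Sum>k\<in>\<Lambda>. \<bar>q n k\<bar>)"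
      using member_le_sum[of k \<Lambda> "\<lambda>k. \<bar>q n k\<bar>"] fin True eC(1) by (intro mult_left_mono) auto
    ultimately have "e * \<bar>q n k\<bar> \<le> \<bar>\<mu>r + 1 + C\<bar>" by (rule order_trans[rotated])
    then show ?thesis using eC(1) by (simp add: pos_le_divide_eq mult.commute)
  qed (use p0(2) eC(1) in simp)
  obtain r1 p' where r1: "strict_mono r1" and p1: "\<And>k. (\<lambda>n. p (r1 n) k) \<longlonglongrightarrow> p' k"
    using coefficients_convergent_subsequence[where x = p and R = 1, OF fin p0(1) norm_polys_coeff_le[OF pq(1)]] by blast
  obtain r2 q' where r2: "strict_mono r2" and q2: "\<And>k. (\<lambda>n. q (r1 (r2 n)) k) \<longlonglongrightarrow> q' k"
    using coefficients_convergent_subsequence[where x = "\<lambda>n. q (r1 n)", OF fin p0(2) qb] by blast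
  define r where "r n = r1 (r2 n)" for n
  have r: "strict_mono r" using r1 r2 by (simp add: r_def strict_mono_def)
  have plim: "(\<lambda>n. p (r n) k) \<longlonglongrightarrow> p' k" for k
    using LIMSEQ_subseq_LIMSEQ[OF p1 r2] by (simp add: r_def o_def)
  have qlim: "(\<lambda>n. q (r n) k) \<longlonglongrightarrow> q' k" for k
    using q2 by (simp add: r_def)
  have q': "q' \<in> nonneg_polys \<Lambda>"
    by (rule nonneg_polys_limit[where x = "\<lambda>n. q (r n)"]) (rule pq qlim)+
  have "p' \<in> nonneg_polys \<Lambda>"
    by (rule nonneg_polys_limit[where x = "\<lambda>n. p (r n)"]) (rule pq(1)[THEN norm_polys_nonneg] plim)+
  moreover have "p' 0 = 1"
    using plim[of 0] pq(1) by (simp add: norm_polys_def LIMSEQ_const_iff)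
  ultimately have p': "p' \<in> norm_polys" by (simp add: norm_polys_def)
  have "dual p' q' \<le> \<mu>"
  proof -
    have Llim: "(\<lambda>n. linear_part (p (r n)) (q (r n))) \<longlonglongrightarrow> linear_part p' q'"
      unfolding linear_part_def by (intro tendsto_intros plim qlim)
    \<comment> \<open>With finite energies the linear part can be subtracted in the reals, which
      identifies the limit of the energies before \<open>energy_lsc\<close> is applied.\<close>
    have ex: "\<exists>t. 0 \<le> t \<and> energy (p (r n)) (q (r n)) = ennreal t" for n
    proof -
      have "energy (p (r n)) (q (r n)) \<noteq> \<infinity>"
        using N[of "r n"] pq(3)[of "r n"] by (auto simp: dual_def)
      then show ?thesis by (cases "energy (p (r n)) (q (r n))") auto
    qed
    then obtain t where t: "\<And>n. 0 \<le> t n" "\<And>n. energy (p (r n)) (q (r n)) = ennreal (t n)"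
      by metis
    have "(\<lambda>n. dual (p (r n)) (q (r n))) \<longlonglongrightarrow> ereal \<mu>r"
      using LIMSEQ_subseq_LIMSEQ[OF dlim r] by (simp add: o_def)
    then have "(\<lambda>n. t n + linear_part (p (r n)) (q (r n))) \<longlonglongrightarrow> \<mu>r"
      by (simp add: dual_def t enn2ereal_ennreal)
    from tendsto_diff[OF this Llim] have tl: "t \<longlonglongrightarrow> \<mu>r - linear_part p' q'" by simp
    then have "0 \<le> \<mu>r - linear_part p' q'"
      using LIMSEQ_le_const t(1) by blast
    have "energy p' q' \<le> liminf (\<lambda>n. energy (p (r n)) (q (r n)))"
      by (rule energy_lsc) (rule pq p' plim qlim)+
    also have "\<dots> = ennreal (\<mu>r - linear_part p' q')"
      unfolding t(2) by (intro lim_imp_Liminf tendsto_ennrealI tl) simp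
    finally have "enn2ereal (energy p' q') \<le> ereal (\<mu>r - linear_part p' q')"
      using \<open>0 \<le> \<mu>r - linear_part p' q'\<close> by (simp add: less_eq_ennreal.rep_eq enn2ereal_ennreal)
    then have "dual p' q' \<le> ereal (\<mu>r - linear_part p' q') + ereal (linear_part p' q')"
      unfolding dual_def by (rule add_right_mono)
    then show ?thesis by (simp add: \<mu>r)
  qed
  moreover have "\<mu> \<le> dual x y" if "x \<in> norm_polys" "y \<in> nonneg_polys \<Lambda>" for x y
    unfolding \<mu>_def using that by (intro Inf_lower) (force simp: V_def)
  ultimately show thesis
    using p' q' by (intro that[of p' q']) (auto intro: order_trans)
qed

end

section \<open>Tangent inequalities\<close>

text \<open>Multiplying the inequality for \<open>n\<close> by \<open>s\<close> gives the next one
  up to the nonnegative remainder (n + 1) t^n (s - t)^2.\<close>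

lemma power_tangent:
  fixes s t :: real
  assumes "0 \<le> s" "0 \<le> t"
  shows "t ^ Suc n + real (Suc n) * t ^ n * (s - t) \<le> s ^ Suc n"
proof (induction n)
  case (Suc n)
  have "t ^ Suc (Suc n) + real (Suc (Suc n)) * t ^ Suc n * (s - t) \<le>
      t ^ Suc (Suc n) + real (Suc (Suc n)) * t ^ Suc n * (s - t) + real (Suc n) * t ^ n * (s - t)\<^sup>2"
    using assms by simp
  also have "\<dots> = s * (t ^ Suc n + real (Suc n) * t ^ n * (s - t))"
    by (simp add: algebra_simps power2_eq_square)
  also have "\<dots> \<le> s * s ^ Suc n"
    using Suc assms by (intro mult_left_mono)
  finally show ?case by simp
qed simp

text \<open>For exponents of at least 2 the remainder in the induction of
  \<open>power_tangent\<close> is strictly positive unless s = t.\<close>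

lemma power_tangent_eqD:
  fixes s t :: real
  assumes "0 < s" "0 < t" "0 < n" and eq: "s ^ Suc n = t ^ Suc n + real (Suc n) * t ^ n * (s - t)"
  shows "s = t"
proof (rule ccontr)
  assume "s \<noteq> t"
  obtain l where n: "n = Suc l" using assms(3) by (cases n) auto
  have "t ^ Suc n + real (Suc n) * t ^ n * (s - t) <
      t ^ Suc n + real (Suc n) * t ^ n * (s - t) + real n * t ^ l * (s - t)\<^sup>2"
    using assms(2,3) \<open>s \<noteq> t\<close> by simp
  also have "\<dots> = s * (t ^ Suc l + real (Suc l) * t ^ l * (s - t))"
    by (simp add: n algebra_simps power2_eq_square)
  also have "\<dots> \<le> s * s ^ Suc l"
    using power_tangent[of s t l] assms(1,2) by (intro mult_left_mono) auto
  finally show False using eq by (simp add: n)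
qed

text \<open>The tangent inequality of the power at 1, applied to x / y, gives the stronger
  \<open>key\<close>; its explicit quadratic gap settles the inequality and the equality case
  together.\<close>

lemma inverse_power_tangent:
  fixes x y :: real
  assumes "0 < x" "0 < y"
  shows "1 / x ^ n - real n * (y - x) / x ^ Suc n \<le> 1 / y ^ n"
    and "0 < n \<Longrightarrow> 1 / y ^ n = 1 / x ^ n - real n * (y - x) / x ^ Suc n \<Longrightarrow> y = x"
proof -
  have key: "1 / x ^ n - real n * (y - x) / x ^ Suc n + real n * (y - x)\<^sup>2 / (y * x ^ Suc n) \<le> 1 / y ^ n"
  proof (cases n)
    case (Suc l)
    have "1 / x ^ n - real n * (y - x) / x ^ Suc n + real n * (y - x)\<^sup>2 / (y * x ^ Suc n) =
        (1 + real n * (x / y - 1)) / x ^ n"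
      using assms by (simp add: field_simps power2_eq_square)
    also have "\<dots> \<le> (x / y) ^ n / x ^ n"
      using power_tangent[of "x / y" 1 l] assms Suc by (intro divide_right_mono) auto
    also have "\<dots> = 1 / y ^ n"
      using assms by (simp add: power_divide)
    finally show ?thesis .
  qed simp
  have "0 \<le> real n * (y - x)\<^sup>2 / (y * x ^ Suc n)"
    using assms by simp
  with key show "1 / x ^ n - real n * (y - x) / x ^ Suc n \<le> 1 / y ^ n" by linarith
  assume "0 < n" "1 / y ^ n = 1 / x ^ n - real n * (y - x) / x ^ Suc n"
  with key have "real n * (y - x)\<^sup>2 / (y * x ^ Suc n) \<le> 0" by linarith
  moreover have "0 < real n * (y - x)\<^sup>2 / (y * x ^ Suc n)" if "y \<noteq> x"
    using that assms \<open>0 < n\<close> by simp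
  ultimately show "y = x" by force
qed

section \<open>Interior minimizers\<close>

context dual_problem
begin

section \<open>The real integrand on the open quadrant\<close>

lemma \<alpha>_nu: "\<alpha> * real (\<nu> - 1) = 1"
  using nu by (auto simp: \<alpha>_def of_nat_diff)

definition J_val :: "real \<Rightarrow> real \<Rightarrow> real" where
  "J_val x y = \<alpha> * (x ^ \<nu> / y ^ (\<nu> - 1)) + \<beta> * (1 / x ^ \<nu>)"

text \<open>\<open>J_x\<close> and \<open>J_y\<close> are the partial derivatives of
  \<open>J_val\<close> for positive arguments. In \<open>J_y\<close> the factor \<alpha> (\<nu> - 1)
  = 1 has cancelled.\<close>

definition J_x :: "real \<Rightarrow> real \<Rightarrow> real" where
  "J_x x y = \<alpha> * real \<nu> * (x / y) ^ (\<nu> - 1) - \<beta> * real \<nu> / x ^ (\<nu> + 1)"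

definition J_y :: "real \<Rightarrow> real \<Rightarrow> real" where
  "J_y x y = - ((x / y) ^ \<nu>)"

text \<open>The first term is \<alpha> y (x / y)^\<nu>, the perspective of a power: y' times the
  tangent inequality of the power at the ratio x / y is its tangent inequality in both variables.
  Equality forces equal ratios, and the term 1 / x^\<nu> then forces x' = x.\<close>

lemma J_val_tangent:
  assumes pos: "0 < x" "0 < y" "0 < x'" "0 < y'"
  shows "J_val x y + J_x x y * (x' - x) + J_y x y * (y' - y) \<le> J_val x' y'" (is "?A \<le> _")
    and "J_val x' y' = J_val x y + J_x x y * (x' - x) + J_y x y * (y' - y) \<Longrightarrow> x' = x \<and> y' = y"
proof -
  obtain n where n: "\<nu> = Suc n" "0 < n" using nu by (cases \<nu>) auto
  have nu1: "\<nu> - 1 = n" "\<nu> - Suc 0 = n" and rn: "real \<nu> = 1 + real n" and pw: "u ^ \<nu> = u * u ^ n" for u :: real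
    using n(1) by simp_all
  have an: "\<alpha> * real n = 1" using \<alpha>_nu nu1 by simp
  define r where "r = x / y"
  define s where "s = x' / y'"
  have rs: "0 < r" "0 < s" "x = r * y" "x' = s * y'" using pos by (auto simp: r_def s_def)
  have hom: "(u * v) ^ Suc n / v ^ n = v * u ^ Suc n" if "0 < v" for u v :: real
    using that by (simp add: power_mult_distrib)
  have split: "?A = \<alpha> * y' * (r ^ Suc n + real (Suc n) * r ^ n * (s - r)) +
      \<beta> * (1 / x ^ \<nu> - real \<nu> * (x' - x) / x ^ Suc \<nu>)"
  proof -
    have xy: "x / y = r" by (simp add: r_def)
    have "\<alpha> * (x ^ \<nu> / y ^ n) + \<alpha> * real (Suc n) * r ^ n * (x' - x) - r ^ Suc n * (y' - y) =
        \<alpha> * y' * (r ^ Suc n + real (Suc n) * r ^ n * (s - r))"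
    proof -
      have "\<alpha> * (x ^ \<nu> / y ^ n) + \<alpha> * real (Suc n) * r ^ n * (x' - x) - r ^ Suc n * (y' - y) =
          \<alpha> * (y * r ^ Suc n) + \<alpha> * real (Suc n) * r ^ n * (s * y' - r * y) - (\<alpha> * real n) * (r ^ Suc n * (y' - y))"
        using hom[OF pos(2), of r] by (simp add: pw an rs(3,4))
      also have "\<dots> = \<alpha> * y' * (r ^ Suc n + real (Suc n) * r ^ n * (s - r))"
        by (simp add: algebra_simps)
      finally show ?thesis .
    qed
    then show ?thesis
      by (simp add: J_val_def J_x_def J_y_def xy nu1 rn pw) (simp add: algebra_simps)
  qed
  have val: "J_val x' y' = \<alpha> * y' * s ^ Suc n + \<beta> * (1 / x' ^ \<nu>)"
    using hom[OF pos(4), of s] by (simp add: J_val_def nu1 pw rs(4))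
  have ay: "0 < \<alpha> * y'" using \<alpha>_pos pos(4) by simp
  have t1: "\<alpha> * y' * (r ^ Suc n + real (Suc n) * r ^ n * (s - r)) \<le> \<alpha> * y' * s ^ Suc n"
    using power_tangent[of s r n] rs ay by (intro mult_left_mono) auto
  have t2: "\<beta> * (1 / x ^ \<nu> - real \<nu> * (x' - x) / x ^ Suc \<nu>) \<le> \<beta> * (1 / x' ^ \<nu>)"
    using inverse_power_tangent(1)[OF pos(1,3), of \<nu>] \<beta>_pos by (intro mult_left_mono) auto
  show "?A \<le> J_val x' y'" unfolding split val using t1 t2 by (rule add_mono)
  assume eq: "J_val x' y' = ?A"
  have e1: "\<alpha> * y' * s ^ Suc n = \<alpha> * y' * (r ^ Suc n + real (Suc n) * r ^ n * (s - r))"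
    and e2: "\<beta> * (1 / x' ^ \<nu>) = \<beta> * (1 / x ^ \<nu> - real \<nu> * (x' - x) / x ^ Suc \<nu>)"
    using t1 t2 eq unfolding split val by linarith+
  have "s = r"
    using e1 ay rs n(2) by (intro power_tangent_eqD[of s r n]) auto
  moreover have "1 / x' ^ \<nu> = 1 / x ^ \<nu> - real \<nu> * (x' - x) / x ^ Suc \<nu>"
    using e2 \<beta>_pos unfolding mult_cancel_left by linarith
  then have "x' = x"
    using inverse_power_tangent(2)[OF pos(1,3), of \<nu>] nu by linarith
  ultimately show "x' = x \<and> y' = y" using rs by auto
qed

lemma continuous_on_J:
  "continuous_on ({0<..} \<times> {0<..}) (\<lambda>z. J_val (fst z) (snd z))"
  "continuous_on ({0<..} \<times> {0<..}) (\<lambda>z. J_x (fst z) (snd z))"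
  "continuous_on ({0<..} \<times> {0<..}) (\<lambda>z. J_y (fst z) (snd z))"
  unfolding J_val_def J_x_def J_y_def by (auto intro!: continuous_intros)

lemma measurable_J [measurable]:
  assumes [measurable]: "f \<in> borel_measurable M" "g \<in> borel_measurable M"
  shows "(\<lambda>x. J_val (f x) (g x)) \<in> borel_measurable M"
    "(\<lambda>x. J_x (f x) (g x)) \<in> borel_measurable M"
    "(\<lambda>x. J_y (f x) (g x)) \<in> borel_measurable M"
  unfolding J_val_def J_x_def J_y_def by measurable

lemma bounded_on_square:
  fixes G :: "real \<Rightarrow> real \<Rightarrow> real"
  assumes "continuous_on ({0<..} \<times> {0<..}) (\<lambda>z. G (fst z) (snd z))" "0 < \<delta>"
  obtains C where "\<And>x y. x \<in> {\<delta>..B} \<Longrightarrow> y \<in> {\<delta>..B} \<Longrightarrow> \<bar>G x y\<bar> \<le> C"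
proof -
  have "compact ({\<delta>..B} \<times> {\<delta>..B})" by (intro compact_Times compact_Icc)
  moreover have "continuous_on ({\<delta>..B} \<times> {\<delta>..B}) (\<lambda>z. G (fst z) (snd z))"
    using assms(2) by (intro continuous_on_subset[OF assms(1)]) auto
  ultimately have "bounded ((\<lambda>z. G (fst z) (snd z)) ` ({\<delta>..B} \<times> {\<delta>..B}))"
    using compact_continuous_image compact_imp_bounded by blast
  then obtain C where "\<forall>z\<in>{\<delta>..B} \<times> {\<delta>..B}. \<bar>G (fst z) (snd z)\<bar> \<le> C"
    unfolding bounded_iff by auto
  then show thesis by (intro that[of C]) auto
qed

text \<open>Positive polynomials take values in a compact interval inside the positive reals, where
  continuous functions are bounded.\<close>

lemma integrable_J:
  assumes "p \<in> pos_polys \<Lambda>" "q \<in> pos_polys \<Lambda>"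
  shows "integrable torus_measure (\<lambda>\<theta>. J_val (trig_val \<Lambda> p \<theta>) (trig_val \<Lambda> q \<theta>))"
    and "integrable torus_measure (\<lambda>\<theta>. J_x (trig_val \<Lambda> p \<theta>) (trig_val \<Lambda> q \<theta>))"
    and "integrable torus_measure (\<lambda>\<theta>. J_y (trig_val \<Lambda> p \<theta>) (trig_val \<Lambda> q \<theta>))"
proof -
  obtain \<delta>1 \<delta>2 where \<delta>: "0 < \<delta>1" "\<And>\<theta>. \<delta>1 \<le> trig_val \<Lambda> p \<theta>" "0 < \<delta>2" "\<And>\<theta>. \<delta>2 \<le> trig_val \<Lambda> q \<theta>"
    using trig_val_pos_bound[of \<Lambda> p] trig_val_pos_bound[of \<Lambda> q] assms unfolding pos_polys_def
    by (metis (no_types, lifting) mem_Collect_eq)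
  define d where "d = min \<delta>1 \<delta>2"
  define B where "B = max (\<Sum>k\<in>\<Lambda>. \<bar>p k\<bar>) (\<Sum>k\<in>\<Lambda>. \<bar>q k\<bar>)"
  have d: "0 < d" using \<delta> by (simp add: d_def)
  have P: "trig_val \<Lambda> p \<theta> \<in> {d..B}" for \<theta>
    using \<delta>(2)[of \<theta>] abs_trig_val_le[of \<Lambda> p \<theta>] by (auto simp: d_def B_def)
  have Q: "trig_val \<Lambda> q \<theta> \<in> {d..B}" for \<theta>
    using \<delta>(4)[of \<theta>] abs_trig_val_le[of \<Lambda> q \<theta>] by (auto simp: d_def B_def)
  have *: "integrable torus_measure (\<lambda>\<theta>. G (trig_val \<Lambda> p \<theta>) (trig_val \<Lambda> q \<theta>))"
    if cont: "continuous_on ({0<..} \<times> {0<..}) (\<lambda>z. G (fst z) (snd z))"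
      and meas: "(\<lambda>\<theta>. G (trig_val \<Lambda> p \<theta>) (trig_val \<Lambda> q \<theta>)) \<in> borel_measurable borel" for G :: "real \<Rightarrow> real \<Rightarrow> real"
  proof -
    obtain C where "\<And>x y. x \<in> {d..B} \<Longrightarrow> y \<in> {d..B} \<Longrightarrow> \<bar>G x y\<bar> \<le> C"
      using bounded_on_square[OF cont d] by blast
    then show ?thesis
      using P Q by (intro integrable_torus_measure_bounded[OF meas, of C]) auto
  qed
  show "integrable torus_measure (\<lambda>\<theta>. J_val (trig_val \<Lambda> p \<theta>) (trig_val \<Lambda> q \<theta>))"
    and "integrable torus_measure (\<lambda>\<theta>. J_x (trig_val \<Lambda> p \<theta>) (trig_val \<Lambda> q \<theta>))"
    and "integrable torus_measure (\<lambda>\<theta>. J_y (trig_val \<Lambda> p \<theta>) (trig_val \<Lambda> q \<theta>))"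
    by (intro * continuous_on_J measurable_J measurable_trig_val)+
qed

lemma pos_polys_nonneg: "q \<in> pos_polys \<Lambda> \<Longrightarrow> q \<in> nonneg_polys \<Lambda>"
  by (auto simp: pos_polys_def nonneg_polys_def intro: less_imp_le)

lemma pos_polys_trig_val_pos: "q \<in> pos_polys \<Lambda> \<Longrightarrow> 0 < trig_val \<Lambda> q \<theta>"
  unfolding pos_polys_def by (metis (no_types, lifting) mem_Collect_eq torus_representative)

lemma integrand_eq:
  assumes "0 < x" "0 < y"
  shows "integrand x y = ennreal (J_val x y)"
proof -
  have e: "ennreal x ^ \<nu> / ennreal y ^ (\<nu> - 1) = ennreal (x ^ \<nu> / y ^ (\<nu> - 1))"
    "1 / ennreal x ^ \<nu> = ennreal (1 / x ^ \<nu>)"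
    using assms by (simp_all add: ennreal_power divide_ennreal flip: ennreal_1)
  have sum: "ennreal \<alpha> * ennreal u + ennreal \<beta> * ennreal v = ennreal (\<alpha> * u + \<beta> * v)"
    if "0 \<le> u" "0 \<le> v" for u v
    using that \<alpha>_pos \<beta>_pos by (simp add: ennreal_mult)
  show ?thesis
    unfolding integrand_def J_val_def e by (rule sum) (use assms in auto)
qed

lemma J_val_nonneg: "0 < x \<Longrightarrow> 0 < y \<Longrightarrow> 0 \<le> J_val x y"
  using \<alpha>_pos \<beta>_pos by (simp add: J_val_def)

lemma dual_interior:
  assumes "p \<in> pos_polys \<Lambda>" "q \<in> pos_polys \<Lambda>"
  shows "dual p q = ereal ((LINT \<theta>|torus_measure. J_val (trig_val \<Lambda> p \<theta>) (trig_val \<Lambda> q \<theta>)) + linear_part p q)"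
proof -
  have nn: "0 \<le> J_val (trig_val \<Lambda> p \<theta>) (trig_val \<Lambda> q \<theta>)" for \<theta>
    using assms by (intro J_val_nonneg pos_polys_trig_val_pos)
  have "energy p q = (\<integral>\<^sup>+\<theta>. ennreal (J_val (trig_val \<Lambda> p \<theta>) (trig_val \<Lambda> q \<theta>)) \<partial>torus_measure)"
    unfolding energy_def using assms by (simp add: integrand_eq pos_polys_trig_val_pos)
  also have "\<dots> = ennreal (LINT \<theta>|torus_measure. J_val (trig_val \<Lambda> p \<theta>) (trig_val \<Lambda> q \<theta>))"
    using nn by (intro nn_integral_eq_integral integrable_J(1)[OF assms]) auto
  finally show ?thesis
    unfolding dual_def using nn by (simp add: integral_nonneg enn2ereal_ennreal)
qed

section \<open>Positivity of minimizers and first-order conditions\<close>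

definition minimizer :: "(int ^ 'd \<Rightarrow> real) \<Rightarrow> (int ^ 'd \<Rightarrow> real) \<Rightarrow> bool" where
  "minimizer p q \<longleftrightarrow> p \<in> norm_polys \<and> q \<in> nonneg_polys \<Lambda> \<and>
    (\<forall>p'\<in>norm_polys. \<forall>q'\<in>nonneg_polys \<Lambda>. dual p q \<le> dual p' q')"

lemma minimizer_energy_finite:
  assumes "minimizer p q"
  shows "energy p q < \<infinity>"
proof -
  have "dual p q \<le> dual one one"
    using assms one_norm_polys norm_polys_nonneg by (auto simp: minimizer_def)
  then have "dual p q < \<infinity>" using dual_one_finite by (rule le_less_trans)
  then show ?thesis by (auto simp: dual_def less_top)
qed

lemma minimizer_P_pos:
  assumes "minimizer p q"
  shows "p \<in> pos_polys \<Lambda>"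
proof -
  have p: "p \<in> nonneg_polys \<Lambda>" using assms by (simp add: minimizer_def norm_polys_def)
  have "trig_val \<Lambda> p \<theta> \<noteq> 0" if "\<theta> \<in> torus" for \<theta>
  proof
    assume 0: "trig_val \<Lambda> p \<theta> = 0"
    have m: "(\<lambda>x. 1 / ennreal (trig_val \<Lambda> p x) ^ \<nu>) \<in> borel_measurable torus_measure"
      by (intro measurable_torus_measure) measurable
    have "ennreal \<beta> * (\<integral>\<^sup>+x. 1 / ennreal (trig_val \<Lambda> p x) ^ \<nu> \<partial>torus_measure) =
        (\<integral>\<^sup>+x. ennreal \<beta> * (1 / ennreal (trig_val \<Lambda> p x) ^ \<nu>) \<partial>torus_measure)"
      using m by (simp add: nn_integral_cmult)
    also have "\<dots> \<le> energy p q"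
      unfolding energy_def integrand_def by (intro nn_integral_mono) simp
    finally show False
      using nn_integral_inverse_power_infinite[OF _ that 0 dim] p minimizer_energy_finite[OF assms] \<beta>_pos
      by (simp add: nonneg_polys_def ennreal_mult_top top_unique)
  qed
  then show ?thesis
    using p by (auto simp: pos_polys_def nonneg_polys_def less_le)
qed

text \<open>If \<open>Q\<close> had a zero, raising \<open>Q\<close> by a constant \<open>\<epsilon>\<close> would decrease the energy at a rate
  \<open>\<integral> P ^ \<nu> / (Q + \<epsilon>) ^ \<nu>\<close>, which tends to \<open>\<infinity>\<close>, while the linear part grows only at rate \<open>c\<^sub>0\<close>.\<close>

lemma minimizer_Q_pos:
  assumes min: "minimizer p q"
  shows "q \<in> pos_polys \<Lambda>"
proof -
  have p: "p \<in> norm_polys" and q: "q \<in> nonneg_polys \<Lambda>"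
    using min by (simp_all add: minimizer_def)
  note ppos = minimizer_P_pos[OF min]
  let ?P = "trig_val \<Lambda> p" and ?Q = "trig_val \<Lambda> q"
  have Pm[measurable]: "?P \<in> borel_measurable torus_measure" "?Q \<in> borel_measurable torus_measure"
    by (intro measurable_torus_measure measurable_trig_val)+
  have Qnn: "0 \<le> ?Q \<theta>" for \<theta>
    using q trig_val_nonneg by (auto simp: nonneg_polys_def)
  note Ppos = pos_polys_trig_val_pos[OF ppos]
  obtain \<delta> where \<delta>: "0 < \<delta>" "\<And>\<theta>. \<delta> \<le> ?P \<theta>"
    using trig_val_pos_bound[of \<Lambda> p] ppos unfolding pos_polys_def by blast
  \<comment> \<open>\<open>D e\<close> bounds the rate of decrease from below, with P replaced by
    its lower bound \<open>\<delta>\<close>.\<close>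
  define D where "D e = (\<integral>\<^sup>+\<theta>. ennreal \<delta> ^ \<nu> / ennreal (?Q \<theta> + e) ^ \<nu> \<partial>torus_measure)" for e
  \<comment> \<open>The competitor Q + e lowers the energy by at least e times \<open>D e\<close>
    and raises the linear part by exactly e times \<open>c 0\<close>; minimality forbids a net
    gain.\<close>
  have D: "D e \<le> ennreal (c 0)" if e: "0 < e" for e
  proof -
    define qe where "qe k = 1 * q k + e * one k" for k
    have tq: "trig_val \<Lambda> qe \<theta> = ?Q \<theta> + e" for \<theta>
      unfolding qe_def trig_val_add by simp
    have qe: "qe \<in> nonneg_polys \<Lambda>"
      using q e one_sym tq by (auto simp: nonneg_polys_def sym_coeffs_def qe_def intro!: add_nonneg_nonneg)
    have lin: "linear_part p qe = linear_part p q + e * c 0"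
    proof -
      have "(\<Sum>k\<in>\<Lambda>. qe k * c k) = (\<Sum>k\<in>\<Lambda>. q k * c k) + e * (\<Sum>k\<in>\<Lambda>. one k * c k)"
        by (simp add: qe_def sum.distrib sum_distrib_left distrib_right mult.assoc)
      also have "(\<Sum>k\<in>\<Lambda>. one k * c k) = (\<Sum>k\<in>\<Lambda>. if k = 0 then c k else 0)"
        by (intro sum.cong) (auto simp: one_def)
      also have "\<dots> = c 0" using fin zero by simp
      finally show ?thesis by (simp add: linear_part_def)
    qed
    have point: "integrand (?P \<theta>) (?Q \<theta> + e) + ennreal e * (ennreal \<delta> ^ \<nu> / ennreal (?Q \<theta> + e) ^ \<nu>) \<le>
        integrand (?P \<theta>) (?Q \<theta>)" for \<theta>
    proof (cases "?Q \<theta> = 0")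
      case True
      then show ?thesis using Ppos[of \<theta>] integrand_at_0 by simp
    next
      case False
      define x y where "x = ?P \<theta>" and "y = ?Q \<theta>"
      have xy: "0 < x" "0 < y" "\<delta> \<le> x"
        using False Qnn[of \<theta>] Ppos[of \<theta>] \<delta> by (auto simp: x_def y_def less_le)
      have "ennreal e * (ennreal \<delta> ^ \<nu> / ennreal z ^ \<nu>) = ennreal (e * (\<delta> ^ \<nu> / z ^ \<nu>))" if "0 < z" for z
        using that e \<delta>(1) by (simp add: ennreal_power divide_ennreal flip: ennreal_mult)
      moreover have "J_val x (y + e) + e * (\<delta> ^ \<nu> / (y + e) ^ \<nu>) \<le> J_val x y"
      proof -
        \<comment> \<open>The tangent in the second variable is taken at y + e and evaluated at y,
          so the slope already involves Q + e.\<close>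
        have "J_val x (y + e) + J_y x (y + e) * (y - (y + e)) \<le> J_val x y"
          using J_val_tangent(1)[of x "y + e" x y] xy e by simp
        moreover have "(\<delta> / (y + e)) ^ \<nu> \<le> (x / (y + e)) ^ \<nu>"
          using xy e \<delta>(1) by (intro power_mono divide_right_mono) auto
        then have "e * (\<delta> / (y + e)) ^ \<nu> \<le> e * (x / (y + e)) ^ \<nu>"
          using e by simp
        ultimately show ?thesis by (simp add: J_y_def power_divide mult.commute)
      qed
      moreover have "0 \<le> J_val x (y + e)" "0 \<le> e * (\<delta> ^ \<nu> / (y + e) ^ \<nu>)"
        using xy e \<delta>(1) by (auto intro!: J_val_nonneg)
      ultimately show ?thesis
        using xy e unfolding x_def[symmetric] y_def[symmetric]
        by (simp add: integrand_eq ennreal_leI ennreal_plus[symmetric] del: ennreal_plus)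
    qed
    have m: "(\<lambda>\<theta>. integrand (?P \<theta>) (?Q \<theta> + e)) \<in> borel_measurable torus_measure"
      "(\<lambda>\<theta>. ennreal \<delta> ^ \<nu> / ennreal (?Q \<theta> + e) ^ \<nu>) \<in> borel_measurable torus_measure"
      by (intro measurable_torus_measure, measurable)+
    have "energy p qe + ennreal e * D e =
        (\<integral>\<^sup>+\<theta>. integrand (?P \<theta>) (?Q \<theta> + e) + ennreal e * (ennreal \<delta> ^ \<nu> / ennreal (?Q \<theta> + e) ^ \<nu>) \<partial>torus_measure)"
      using m by (simp add: energy_def tq D_def nn_integral_add nn_integral_cmult)
    also have "\<dots> \<le> energy p q"
      unfolding energy_def by (intro nn_integral_mono point)
    finally have le: "energy p qe + ennreal e * D e \<le> energy p q" .
    have fin1: "energy p q < \<infinity>" by (rule minimizer_energy_finite[OF min])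
    obtain s where s: "energy p q = ennreal s" "0 \<le> s"
      using fin1 by (cases "energy p q") auto
    have "energy p qe + ennreal e * D e \<noteq> \<infinity>"
      using le fin1 by (metis infinity_ennreal_def leD)
    then have "energy p qe \<noteq> \<infinity>" "ennreal e * D e \<noteq> \<infinity>" by auto
    then have "D e \<noteq> \<infinity>" using e by (auto simp: ennreal_mult_top)
    obtain s' where s': "energy p qe = ennreal s'" "0 \<le> s'"
      using \<open>energy p qe \<noteq> \<infinity>\<close> by (cases "energy p qe") auto
    obtain d where d: "D e = ennreal d" "0 \<le> d"
      using \<open>D e \<noteq> \<infinity>\<close> by (cases "D e") auto
    have "dual p q \<le> dual p qe"
      using min p qe by (simp add: minimizer_def)
    then have "s + linear_part p q \<le> s' + (linear_part p q + e * c 0)"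
      using s s' by (simp add: dual_def lin)
    moreover have "s' + e * d \<le> s"
      using le s s' d e by (simp flip: ennreal_mult ennreal_plus)
    ultimately have "e * d \<le> e * c 0" by linarith
    then show ?thesis using e d by (simp add: ennreal_leI)
  qed
  \<comment> \<open>As e tends to 0 along this sequence, Fatou carries the uniform bound
    \<open>c 0\<close> over to the integrand with Q itself.\<close>
  define E where "E n = inverse (real (Suc n))" for n
  have E: "E \<longlonglongrightarrow> 0" "\<And>n. 0 < E n"
    using LIMSEQ_inverse_real_of_nat by (simp_all add: E_def[abs_def])
  have "(\<integral>\<^sup>+\<theta>. ennreal \<delta> ^ \<nu> / ennreal (?Q \<theta>) ^ \<nu> \<partial>torus_measure) =
      (\<integral>\<^sup>+\<theta>. liminf (\<lambda>n. ennreal \<delta> ^ \<nu> / ennreal (?Q \<theta> + E n) ^ \<nu>) \<partial>torus_measure)"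
  proof (rule nn_integral_cong)
    fix \<theta>
    have "(\<lambda>n. ennreal (\<delta> ^ \<nu>) * inverse (ennreal ((?Q \<theta> + E n) ^ \<nu>))) \<longlonglongrightarrow>
        ennreal (\<delta> ^ \<nu>) * inverse (ennreal ((?Q \<theta> + 0) ^ \<nu>))"
      using \<delta>(1)
      by (intro tendsto_mult_ennreal tendsto_inverse_ennreal tendsto_ennrealI tendsto_power
          tendsto_add tendsto_const E(1)) auto
    moreover have "ennreal \<delta> ^ \<nu> / ennreal y ^ \<nu> = ennreal (\<delta> ^ \<nu>) * inverse (ennreal (y ^ \<nu>))" if "0 \<le> y" for y
      using \<delta>(1) that by (simp add: divide_ennreal_def ennreal_power)
    moreover have "0 \<le> ?Q \<theta> + E n" for n
      using Qnn[of \<theta>] E(2)[of n] by simp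
    ultimately have "(\<lambda>n. ennreal \<delta> ^ \<nu> / ennreal (?Q \<theta> + E n) ^ \<nu>) \<longlonglongrightarrow> ennreal \<delta> ^ \<nu> / ennreal (?Q \<theta>) ^ \<nu>"
      using Qnn[of \<theta>] by (simp only: add_0_right)
    then show "ennreal \<delta> ^ \<nu> / ennreal (?Q \<theta>) ^ \<nu> = liminf (\<lambda>n. ennreal \<delta> ^ \<nu> / ennreal (?Q \<theta> + E n) ^ \<nu>)"
      by (simp add: lim_imp_Liminf)
  qed
  also have "\<dots> \<le> liminf (\<lambda>n. D (E n))"
    unfolding D_def by (intro nn_integral_liminf measurable_torus_measure) measurable
  also have "\<dots> \<le> ennreal (c 0)"
    using Liminf_mono[of "\<lambda>n. D (E n)" "\<lambda>_. ennreal (c 0)" sequentially] D E(2) by (simp add: Liminf_const)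
  also have "\<dots> < \<infinity>" by simp
  finally have fin2: "(\<integral>\<^sup>+\<theta>. ennreal \<delta> ^ \<nu> / ennreal (?Q \<theta>) ^ \<nu> \<partial>torus_measure) < \<infinity>" .
  have "?Q \<theta> \<noteq> 0" if "\<theta> \<in> torus" for \<theta>
  proof
    assume 0: "?Q \<theta> = 0"
    have "(\<lambda>x. 1 / ennreal (?Q x) ^ \<nu>) \<in> borel_measurable torus_measure"
      by (intro measurable_torus_measure) measurable
    then have "(\<integral>\<^sup>+\<theta>. ennreal \<delta> ^ \<nu> / ennreal (?Q \<theta>) ^ \<nu> \<partial>torus_measure) =
        ennreal \<delta> ^ \<nu> * (\<integral>\<^sup>+x. 1 / ennreal (?Q x) ^ \<nu> \<partial>torus_measure)"
      by (subst nn_integral_cmult[symmetric]) (simp_all add: ennreal_times_divide)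
    also have "\<dots> = \<infinity>"
      using nn_integral_inverse_power_infinite[OF _ that 0 dim] q \<delta>(1)
      by (simp add: nonneg_polys_def ennreal_mult_top)
    finally show False using fin2 by simp
  qed
  then show ?thesis
    using q by (auto simp: pos_polys_def nonneg_polys_def less_le)
qed

text \<open>The tangent inequality is taken at the perturbed pair and evaluated at the minimizer.
  Minimality then makes the directional derivative at the perturbed pair nonnegative, and dominated
  convergence carries this to the minimizer. The condition \<open>g 0 = 0\<close> preserves p_0 =
  1.\<close>

lemma stationarity_le:
  assumes min: "minimizer p q" and g: "g \<in> sym_coeffs \<Lambda>" "g 0 = 0" and h: "h \<in> sym_coeffs \<Lambda>"
  shows "0 \<le> (LINT \<theta>|torus_measure. trig_val \<Lambda> g \<theta> * J_x (trig_val \<Lambda> p \<theta>) (trig_val \<Lambda> q \<theta>)) +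
    (LINT \<theta>|torus_measure. trig_val \<Lambda> h \<theta> * J_y (trig_val \<Lambda> p \<theta>) (trig_val \<Lambda> q \<theta>)) + linear_part g h"
proof -
  let ?P = "trig_val \<Lambda> p" and ?Q = "trig_val \<Lambda> q" and ?G = "trig_val \<Lambda> g" and ?H = "trig_val \<Lambda> h"
  note pp = minimizer_P_pos[OF min] and qp = minimizer_Q_pos[OF min]
  have pq: "p \<in> norm_polys" using min by (simp add: minimizer_def)
  obtain \<delta>1 \<delta>2 where \<delta>12: "0 < \<delta>1" "\<And>\<theta>. \<delta>1 \<le> ?P \<theta>" "0 < \<delta>2" "\<And>\<theta>. \<delta>2 \<le> ?Q \<theta>"
    using trig_val_pos_bound[of \<Lambda> p] trig_val_pos_bound[of \<Lambda> q] pp qp unfolding pos_polys_def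
    by (metis (no_types, lifting) mem_Collect_eq)
  define d where "d = min \<delta>1 \<delta>2"
  have d: "0 < d" "\<And>\<theta>. d \<le> ?P \<theta>" "\<And>\<theta>. d \<le> ?Q \<theta>"
    using \<delta>12 by (auto simp: d_def intro: min.coboundedI1 min.coboundedI2)
  define N where "N = 1 + (\<Sum>k\<in>\<Lambda>. \<bar>g k\<bar>) + (\<Sum>k\<in>\<Lambda>. \<bar>h k\<bar>)"
  have N: "0 < N" "\<And>\<theta>. \<bar>?G \<theta>\<bar> \<le> N" "\<And>\<theta>. \<bar>?H \<theta>\<bar> \<le> N"
  proof -
    have "0 \<le> (\<Sum>k\<in>\<Lambda>. \<bar>g k\<bar>)" "0 \<le> (\<Sum>k\<in>\<Lambda>. \<bar>h k\<bar>)"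
      by (simp_all add: sum_nonneg)
    then show "0 < N" "\<bar>?G \<theta>\<bar> \<le> N" "\<bar>?H \<theta>\<bar> \<le> N" for \<theta>
      using abs_trig_val_le[of \<Lambda> g \<theta>] abs_trig_val_le[of \<Lambda> h \<theta>] unfolding N_def by linarith+
  qed
  \<comment> \<open>The factor d / (2 N) limits each perturbation to d / 2, so the perturbed
    polynomials keep the lower bound d / 2.\<close>
  define t where "t n = d / (2 * N) * inverse (real (Suc n))" for n
  have t: "0 < t n" for n using d N by (simp add: t_def)
  have tN: "t n * N \<le> d / 2" for n
  proof -
    have "t n * N = d / 2 * inverse (real (Suc n))" using N(1) by (simp add: t_def)
    also have "\<dots> \<le> d / 2 * 1"
      using d(1) by (intro mult_left_mono) (auto simp: inverse_le_1_iff)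
    finally show ?thesis by simp
  qed
  have t0: "t \<longlonglongrightarrow> 0"
    unfolding t_def using tendsto_mult[OF tendsto_const LIMSEQ_inverse_real_of_nat, of "d / (2 * N)"] by simp
  have small: "\<bar>t n * u\<bar> \<le> d / 2" if "\<bar>u\<bar> \<le> N" for u n
  proof -
    have "\<bar>t n * u\<bar> = t n * \<bar>u\<bar>" using t[of n] by (simp add: abs_mult)
    also have "\<dots> \<le> t n * N" using t[of n] that by simp
    also note tN
    finally show ?thesis .
  qed
  note tG = small[OF N(2)] and tH = small[OF N(3)]
  define B where "B = max (\<Sum>k\<in>\<Lambda>. \<bar>p k\<bar>) (\<Sum>k\<in>\<Lambda>. \<bar>q k\<bar>) + d"
  define pt where "pt n k = 1 * p k + t n * g k" for n k
  define qt where "qt n k = 1 * q k + t n * h k" for n k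
  have tpt: "trig_val \<Lambda> (pt n) \<theta> = ?P \<theta> + t n * ?G \<theta>" for n \<theta>
    unfolding pt_def trig_val_add by simp
  have tqt: "trig_val \<Lambda> (qt n) \<theta> = ?Q \<theta> + t n * ?H \<theta>" for n \<theta>
    unfolding qt_def trig_val_add by simp
  have rng: "trig_val \<Lambda> (pt n) \<theta> \<in> {d / 2..B}" "trig_val \<Lambda> (qt n) \<theta> \<in> {d / 2..B}" for n \<theta>
    using tG[of n \<theta>] tH[of n \<theta>] d(2,3)[of \<theta>] d(1) abs_trig_val_le[of \<Lambda> p \<theta>] abs_trig_val_le[of \<Lambda> q \<theta>]
    unfolding tpt tqt B_def by (auto simp: abs_le_iff)
  have pt: "pt n \<in> pos_polys \<Lambda>" and qt: "qt n \<in> pos_polys \<Lambda>" for n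
    using rng[of n] d(1) pp qp g h
    by (auto simp: pos_polys_def sym_coeffs_def pt_def qt_def intro: less_le_trans[of 0 "d / 2"])
  have ptn: "pt n \<in> norm_polys" for n
    using pos_polys_nonneg[OF pt[of n]] g(2) pq by (simp add: norm_polys_def pt_def)
  let ?K = "\<lambda>n. (LINT \<theta>|torus_measure. ?G \<theta> * J_x (trig_val \<Lambda> (pt n) \<theta>) (trig_val \<Lambda> (qt n) \<theta>)) +
      (LINT \<theta>|torus_measure. ?H \<theta> * J_y (trig_val \<Lambda> (pt n) \<theta>) (trig_val \<Lambda> (qt n) \<theta>))"
  have ge: "0 \<le> ?K n + linear_part g h" for n
  proof -
    let ?Pt = "trig_val \<Lambda> (pt n)" and ?Qt = "trig_val \<Lambda> (qt n)"
    note iG = integral_trig_val_mult(1)[OF integrable_J(2)[OF pt[of n] qt[of n]], of \<Lambda> g]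
    note iH = integral_trig_val_mult(1)[OF integrable_J(3)[OF pt[of n] qt[of n]], of \<Lambda> h]
    note iv = integrable_J(1)[OF pt[of n] qt[of n]]
    note iv0 = integrable_J(1)[OF pp qp]
    have "dual p q \<le> dual (pt n) (qt n)"
      using min ptn pos_polys_nonneg[OF qt] by (simp add: minimizer_def)
    then have 1: "(LINT \<theta>|torus_measure. J_val (?P \<theta>) (?Q \<theta>)) + linear_part p q \<le>
        (LINT \<theta>|torus_measure. J_val (?Pt \<theta>) (?Qt \<theta>)) + linear_part (pt n) (qt n)"
      by (simp add: dual_interior pp qp pt qt)
    have lin: "linear_part (pt n) (qt n) = linear_part p q + t n * linear_part g h"
      by (simp add: linear_part_def pt_def qt_def distrib_right sum.distrib sum_distrib_left
          right_diff_distrib mult.assoc)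
    have le: "(LINT \<theta>|torus_measure. J_val (?Pt \<theta>) (?Qt \<theta>) - t n * (?G \<theta> * J_x (?Pt \<theta>) (?Qt \<theta>) + ?H \<theta> * J_y (?Pt \<theta>) (?Qt \<theta>)))
        \<le> (LINT \<theta>|torus_measure. J_val (?P \<theta>) (?Q \<theta>))"
    proof (rule integral_mono)
      show "integrable torus_measure (\<lambda>\<theta>. J_val (?Pt \<theta>) (?Qt \<theta>) - t n * (?G \<theta> * J_x (?Pt \<theta>) (?Qt \<theta>) + ?H \<theta> * J_y (?Pt \<theta>) (?Qt \<theta>)))"
        by (intro Bochner_Integration.integrable_diff integrable_mult_right Bochner_Integration.integrable_add iv iG iH)
      show "J_val (?Pt \<theta>) (?Qt \<theta>) - t n * (?G \<theta> * J_x (?Pt \<theta>) (?Qt \<theta>) + ?H \<theta> * J_y (?Pt \<theta>) (?Qt \<theta>)) \<le> J_val (?P \<theta>) (?Q \<theta>)" for \<theta>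
        using J_val_tangent(1)[OF pos_polys_trig_val_pos[OF pt[of n], of \<theta>] pos_polys_trig_val_pos[OF qt[of n], of \<theta>]
            pos_polys_trig_val_pos[OF pp, of \<theta>] pos_polys_trig_val_pos[OF qp, of \<theta>]]
        by (simp add: tpt tqt algebra_simps)
    qed (rule iv0)
    have "(LINT \<theta>|torus_measure. J_val (?Pt \<theta>) (?Qt \<theta>) - t n * (?G \<theta> * J_x (?Pt \<theta>) (?Qt \<theta>) + ?H \<theta> * J_y (?Pt \<theta>) (?Qt \<theta>))) =
        (LINT \<theta>|torus_measure. J_val (?Pt \<theta>) (?Qt \<theta>)) - t n * ?K n"
      using iv iG iH by simp
    then have "0 \<le> t n * ?K n + t n * linear_part g h"
      using 1 lin le by linarith
    then have "0 \<le> t n * (?K n + linear_part g h)"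
      by (simp only: distrib_left)
    then show ?thesis using t[of n] by (simp add: zero_le_mult_iff)
  qed
  have lim: "(\<lambda>n. LINT \<theta>|torus_measure. trig_val \<Lambda> f \<theta> * F (trig_val \<Lambda> (pt n) \<theta>) (trig_val \<Lambda> (qt n) \<theta>)) \<longlonglongrightarrow>
      (LINT \<theta>|torus_measure. trig_val \<Lambda> f \<theta> * F (?P \<theta>) (?Q \<theta>))"
    if cont: "continuous_on ({0<..} \<times> {0<..}) (\<lambda>z. F (fst z) (snd z))"
      and meas: "\<And>u v :: real ^ 'd \<Rightarrow> real. u \<in> borel_measurable borel \<Longrightarrow> v \<in> borel_measurable borel \<Longrightarrow>
        (\<lambda>\<theta>. F (u \<theta>) (v \<theta>)) \<in> borel_measurable borel" for f and F :: "real \<Rightarrow> real \<Rightarrow> real"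
  proof -
    obtain C where C: "\<And>x y. x \<in> {d / 2..B} \<Longrightarrow> y \<in> {d / 2..B} \<Longrightarrow> \<bar>F x y\<bar> \<le> C"
      using bounded_on_square[OF cont, of "d / 2" B] d(1) by auto
    let ?w = "(\<Sum>k\<in>\<Lambda>. \<bar>f k\<bar>) * C"
    show ?thesis
    proof (rule integral_dominated_convergence[where w = "\<lambda>_. ?w"])
      show "(\<lambda>\<theta>. trig_val \<Lambda> f \<theta> * F (?P \<theta>) (?Q \<theta>)) \<in> borel_measurable torus_measure"
        "(\<lambda>\<theta>. trig_val \<Lambda> f \<theta> * F (trig_val \<Lambda> (pt n) \<theta>) (trig_val \<Lambda> (qt n) \<theta>)) \<in> borel_measurable torus_measure" for n
        by (intro measurable_torus_measure borel_measurable_times meas[OF measurable_trig_val measurable_trig_val]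
            measurable_trig_val)+
      show "integrable torus_measure (\<lambda>_ :: real ^ 'd. ?w)"
        by (rule integrable_torus_measure_bounded) auto
      show "AE \<theta> in torus_measure. (\<lambda>n. trig_val \<Lambda> f \<theta> * F (trig_val \<Lambda> (pt n) \<theta>) (trig_val \<Lambda> (qt n) \<theta>))
          \<longlonglongrightarrow> trig_val \<Lambda> f \<theta> * F (?P \<theta>) (?Q \<theta>)"
      proof (intro always_eventually allI tendsto_mult tendsto_const)
        fix \<theta>
        have "(\<lambda>n. (?P \<theta> + t n * ?G \<theta>, ?Q \<theta> + t n * ?H \<theta>)) \<longlonglongrightarrow> (?P \<theta> + 0 * ?G \<theta>, ?Q \<theta> + 0 * ?H \<theta>)"
          by (intro tendsto_intros t0)
        then have l: "(\<lambda>n. (trig_val \<Lambda> (pt n) \<theta>, trig_val \<Lambda> (qt n) \<theta>)) \<longlonglongrightarrow> (?P \<theta>, ?Q \<theta>)"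
          by (simp add: tpt tqt)
        have "(\<lambda>n. (\<lambda>z. F (fst z) (snd z)) (trig_val \<Lambda> (pt n) \<theta>, trig_val \<Lambda> (qt n) \<theta>)) \<longlonglongrightarrow>
            (\<lambda>z. F (fst z) (snd z)) (?P \<theta>, ?Q \<theta>)"
          using pos_polys_trig_val_pos pt qt pp qp
          by (intro continuous_on_tendsto_compose[OF cont l]) auto
        then show "(\<lambda>n. F (trig_val \<Lambda> (pt n) \<theta>) (trig_val \<Lambda> (qt n) \<theta>)) \<longlonglongrightarrow> F (?P \<theta>) (?Q \<theta>)" by simp
      qed
      show "AE \<theta> in torus_measure. norm (trig_val \<Lambda> f \<theta> * F (trig_val \<Lambda> (pt n) \<theta>) (trig_val \<Lambda> (qt n) \<theta>)) \<le> ?w" for n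
      proof (intro always_eventually allI)
        fix \<theta>
        have "\<bar>trig_val \<Lambda> f \<theta>\<bar> * \<bar>F (trig_val \<Lambda> (pt n) \<theta>) (trig_val \<Lambda> (qt n) \<theta>)\<bar> \<le> ?w"
          by (intro mult_mono abs_trig_val_le C rng sum_nonneg) auto
        then show "norm (trig_val \<Lambda> f \<theta> * F (trig_val \<Lambda> (pt n) \<theta>) (trig_val \<Lambda> (qt n) \<theta>)) \<le> ?w"
          by (simp add: abs_mult)
      qed
    qed
  qed
  have "(\<lambda>n. ?K n + linear_part g h) \<longlonglongrightarrow> (LINT \<theta>|torus_measure. ?G \<theta> * J_x (?P \<theta>) (?Q \<theta>)) +
      (LINT \<theta>|torus_measure. ?H \<theta> * J_y (?P \<theta>) (?Q \<theta>)) + linear_part g h"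
    by (intro tendsto_add tendsto_const lim[OF continuous_on_J(2) measurable_J(2)]
        lim[OF continuous_on_J(3) measurable_J(3)])
  then show ?thesis
    by (rule LIMSEQ_le_const) (use ge in blast)
qed

lemma trig_val_uminus: "trig_val \<Lambda> (\<lambda>k. - g k) \<theta> = - trig_val \<Lambda> g \<theta>"
  by (simp add: trig_val_sum sum_negf)

text \<open>The left side is linear in (g, h), and \<open>stationarity_le\<close> applies to both
  signs of the direction.\<close>

lemma stationarity:
  assumes min: "minimizer p q" and g: "g \<in> sym_coeffs \<Lambda>" "g 0 = 0" and h: "h \<in> sym_coeffs \<Lambda>"
  shows "(LINT \<theta>|torus_measure. trig_val \<Lambda> g \<theta> * J_x (trig_val \<Lambda> p \<theta>) (trig_val \<Lambda> q \<theta>)) +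
    (LINT \<theta>|torus_measure. trig_val \<Lambda> h \<theta> * J_y (trig_val \<Lambda> p \<theta>) (trig_val \<Lambda> q \<theta>)) + linear_part g h = 0"
proof -
  have "(\<lambda>k. - g k) \<in> sym_coeffs \<Lambda>" "(\<lambda>k. - h k) \<in> sym_coeffs \<Lambda>"
    using g h by (auto simp: sym_coeffs_def)
  moreover have "linear_part (\<lambda>k. - g k) (\<lambda>k. - h k) = - linear_part g h"
    by (simp add: linear_part_def sum_negf)
  ultimately show ?thesis
    using stationarity_le[OF min g h] stationarity_le[OF min, of "\<lambda>k. - g k" "\<lambda>k. - h k"] g(2)
    by (simp add: trig_val_uminus)
qed

section \<open>Uniqueness\<close>

lemma trig_val_AE_eq_imp:
  assumes "p \<in> sym_coeffs \<Lambda>" "p' \<in> sym_coeffs \<Lambda>"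
    and "AE \<theta> in torus_measure. trig_val \<Lambda> p' \<theta> = trig_val \<Lambda> p \<theta>"
  shows "p' = p"
proof -
  define g where "g k = 1 * p' k + (- 1) * p k" for k
  have gt: "trig_val \<Lambda> g \<theta> = trig_val \<Lambda> p' \<theta> - trig_val \<Lambda> p \<theta>" for \<theta>
    unfolding g_def trig_val_add by simp
  have gs: "g \<in> sym_coeffs \<Lambda>" using assms(1,2) by (simp add: sym_coeffs_def g_def)
  have "g = (\<lambda>_. 0)"
  proof (rule ccontr)
    assume "g \<noteq> (\<lambda>_. 0)"
    from AE_trig_val_nonzero[OF fin sym gs this] assms(3)
    have "AE \<theta> in (torus_measure :: (real ^ 'd) measure). False"
      by eventually_elim (simp add: gt)
    then show False using not_AE_torus_measure_False by blast
  qed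
  then show ?thesis by (simp add: g_def fun_eq_iff)
qed

text \<open>The difference of two minimal values is the integral of the gap in the tangent
  inequality at the first minimizer, so this gap vanishes almost everywhere.\<close>

lemma minimizer_unique:
  assumes 1: "minimizer p q" and 2: "minimizer p' q'"
  shows "p' = p \<and> q' = q"
proof -
  note pos = minimizer_P_pos[OF 1] minimizer_Q_pos[OF 1] minimizer_P_pos[OF 2] minimizer_Q_pos[OF 2]
  let ?P = "trig_val \<Lambda> p" and ?Q = "trig_val \<Lambda> q" and ?P' = "trig_val \<Lambda> p'" and ?Q' = "trig_val \<Lambda> q'"
  define g where "g k = 1 * p' k + (- 1) * p k" for k
  define h where "h k = 1 * q' k + (- 1) * q k" for k
  have gt: "trig_val \<Lambda> g \<theta> = ?P' \<theta> - ?P \<theta>" and ht: "trig_val \<Lambda> h \<theta> = ?Q' \<theta> - ?Q \<theta>" for \<theta>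
    unfolding g_def h_def trig_val_add by simp_all
  have syms: "p \<in> sym_coeffs \<Lambda>" "q \<in> sym_coeffs \<Lambda>" "p' \<in> sym_coeffs \<Lambda>" "q' \<in> sym_coeffs \<Lambda>"
    using pos by (simp_all add: pos_polys_def)
  have gs: "g \<in> sym_coeffs \<Lambda>" "g 0 = 0" and hs: "h \<in> sym_coeffs \<Lambda>"
    using syms 1 2 by (simp_all add: sym_coeffs_def g_def h_def minimizer_def norm_polys_def)
  note st = stationarity[OF 1 gs hs]
  have lin: "linear_part g h = linear_part p' q' - linear_part p q"
    by (simp add: linear_part_def g_def h_def left_diff_distrib sum_subtractf)
  have "dual p q = dual p' q'"
    using 1 2 by (intro antisym) (auto simp: minimizer_def)
  then have eq: "(LINT \<theta>|torus_measure. J_val (?P \<theta>) (?Q \<theta>)) + linear_part p q =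
      (LINT \<theta>|torus_measure. J_val (?P' \<theta>) (?Q' \<theta>)) + linear_part p' q'"
    by (simp add: dual_interior pos)
  let ?gap = "\<lambda>\<theta>. J_val (?P' \<theta>) (?Q' \<theta>) - J_val (?P \<theta>) (?Q \<theta>) -
      (trig_val \<Lambda> g \<theta> * J_x (?P \<theta>) (?Q \<theta>) + trig_val \<Lambda> h \<theta> * J_y (?P \<theta>) (?Q \<theta>))"
  note i = integrable_J(1)[OF pos(3,4)] integrable_J(1)[OF pos(1,2)]
    integral_trig_val_mult(1)[OF integrable_J(2)[OF pos(1,2)], of \<Lambda> g]
    integral_trig_val_mult(1)[OF integrable_J(3)[OF pos(1,2)], of \<Lambda> h]
  have int: "integrable torus_measure ?gap"
    by (intro Bochner_Integration.integrable_diff Bochner_Integration.integrable_add i)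
  have "(LINT \<theta>|torus_measure. ?gap \<theta>) = 0"
    using i eq st lin by simp
  moreover have nn: "0 \<le> ?gap \<theta>" for \<theta>
    using J_val_tangent(1)[of "?P \<theta>" "?Q \<theta>" "?P' \<theta>" "?Q' \<theta>"] pos pos_polys_trig_val_pos
    by (simp add: gt ht mult.commute)
  ultimately have gap0: "AE \<theta> in torus_measure. ?gap \<theta> = 0"
    using integral_nonneg_eq_0_iff_AE[OF int] by simp
  have both: "?P' \<theta> = ?P \<theta> \<and> ?Q' \<theta> = ?Q \<theta>" if "?gap \<theta> = 0" for \<theta>
    using J_val_tangent(2)[of "?P \<theta>" "?Q \<theta>" "?P' \<theta>" "?Q' \<theta>"] pos pos_polys_trig_val_pos that
    by (simp add: gt ht algebra_simps)
  have "AE \<theta> in torus_measure. ?P' \<theta> = ?P \<theta>" "AE \<theta> in torus_measure. ?Q' \<theta> = ?Q \<theta>"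
    using gap0 by (eventually_elim, use both in blast)+
  then show ?thesis
    using trig_val_AE_eq_imp syms by blast
qed

section \<open>The moment conditions\<close>

lemma trig_val_reflect: "trig_val \<Lambda> q ((\<chi> j. 2 * pi) - \<theta>) = trig_val \<Lambda> q \<theta>"
proof -
  have c: "(\<chi> j. 2 * pi :: real ^ 'd) = (\<chi> j. 2 * pi * real_of_int 1)" by simp
  have "cos (pairing k ((\<chi> j. 2 * pi) - \<theta>)) = cos (pairing k \<theta>)" for k
    unfolding pairing_diff by (subst c, unfold pairing_period cos_diff cos_int_2pin sin_int_2pin) simp
  then show ?thesis by (simp add: trig_val_sum)
qed

text \<open>The coefficients of 2 cos \<langle>k, \<theta>\<rangle>, a symmetric test direction for
  the index \<open>k\<close>. For k = 0 the two summands coincide and give the constant 2.\<close>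

definition pair_coeffs :: "int ^ 'd \<Rightarrow> int ^ 'd \<Rightarrow> real" where
  "pair_coeffs k j = (if j = k then 1 else 0) + (if j = - k then 1 else 0)"

lemma pair_coeffs_sym: "k \<in> \<Lambda> \<Longrightarrow> pair_coeffs k \<in> sym_coeffs \<Lambda>"
  using sym by (auto simp: sym_coeffs_def pair_coeffs_def)

lemma sum_pair_coeffs:
  assumes "finite A" "k \<in> A" "- k \<in> A"
  shows "(\<Sum>j\<in>A. pair_coeffs k j * f j) = f k + f (- k)"
proof -
  have "(\<Sum>j\<in>A. pair_coeffs k j * f j) = (\<Sum>j\<in>A. (if j = k then f j else 0) + (if j = - k then f j else 0))"
  proof -
    have "(if b then 1 else 0) * x = (if b then x else 0)" for b and x :: real by simp
    then show ?thesis by (simp only: pair_coeffs_def distrib_right)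
  qed
  then show ?thesis using assms by (simp add: sum.distrib)
qed

text \<open>A function of the values of P and Q inherits their invariance under \<theta> -> 2 pi -
  \<theta>, so its sine integrals vanish.\<close>

lemma moment_real:
  assumes "integrable torus_measure (\<lambda>\<theta>. F (trig_val \<Lambda> p \<theta>) (trig_val \<Lambda> q \<theta>))"
    and "(\<lambda>\<theta>. F (trig_val \<Lambda> p \<theta>) (trig_val \<Lambda> q \<theta>)) \<in> borel_measurable borel"
  shows "moment (\<lambda>\<theta>. F (trig_val \<Lambda> p \<theta>) (trig_val \<Lambda> q \<theta>)) k =
    complex_of_real (Re (moment (\<lambda>\<theta>. F (trig_val \<Lambda> p \<theta>) (trig_val \<Lambda> q \<theta>)) k))"
  using Im_moment[OF assms(1), of k] integral_torus_sin_eq_0[OF assms(2), of k]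
  by (simp add: complex_eq_iff trig_val_reflect)

lemma Re_moment_uminus: "integrable torus_measure f \<Longrightarrow> Re (moment f (- k)) = Re (moment f k)"
  by (simp add: Re_moment pairing_uminus)

text \<open>Stationarity in the direction (0, \<open>pair_coeffs k\<close>) equates c_k + c_(-k)
  with twice the real part of the moment.\<close>

lemma minimizer_moments_c:
  assumes min: "minimizer p q" and k: "k \<in> \<Lambda>" and c: "c (- k) = c k"
  shows "complex_of_real (c k) = moment (\<lambda>\<theta>. (trig_val \<Lambda> p \<theta> / trig_val \<Lambda> q \<theta>) ^ \<nu>) k"
proof -
  note pos = minimizer_P_pos[OF min] minimizer_Q_pos[OF min]
  have mk: "- k \<in> \<Lambda>" using k sym by blast
  have zero: "(\<lambda>_. 0) \<in> sym_coeffs \<Lambda>" by (simp add: sym_coeffs_def)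
  let ?F = "\<lambda>\<theta>. (trig_val \<Lambda> p \<theta> / trig_val \<Lambda> q \<theta>) ^ \<nu>"
  have int: "integrable torus_measure ?F"
    using integrable_J(3)[OF pos] by (simp add: J_y_def)
  have "(LINT \<theta>|torus_measure. trig_val \<Lambda> (pair_coeffs k) \<theta> * ?F \<theta>) = c k + c (- k)"
    using stationarity[OF min zero _ pair_coeffs_sym[OF k]] sum_pair_coeffs[OF fin k mk, of c]
    by (simp add: J_y_def linear_part_def trig_val_sum[of _ "\<lambda>_. 0"])
  then have "c k = Re (moment ?F k)"
    using integral_trig_val_mult(2)[OF int, of \<Lambda> "pair_coeffs k"] c
      sum_pair_coeffs[OF fin k mk, of "\<lambda>j. Re (moment ?F j)"] Re_moment_uminus[OF int, of k]
    by simp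
  moreover have "?F \<in> borel_measurable borel" by measurable
  ultimately show ?thesis
    using moment_real[of "\<lambda>x y. (x / y) ^ \<nu>" p q k] int by simp
qed

text \<open>Stationarity in the direction (\<open>pair_coeffs k\<close>, 0), which preserves p_0 = 1
  because k is nonzero.\<close>

lemma minimizer_moments_m:
  assumes min: "minimizer p q" and k: "k \<in> \<Lambda> - {0}" and m: "m (- k) = m k"
  shows "complex_of_real (m k) = moment (\<lambda>\<theta>. real \<nu> / (real \<nu> - 1) *
    ((trig_val \<Lambda> p \<theta> / trig_val \<Lambda> q \<theta>) ^ (\<nu> - 1) - lam / trig_val \<Lambda> p \<theta> ^ (\<nu> + 1))) k"
proof -
  note pos = minimizer_P_pos[OF min] minimizer_Q_pos[OF min]
  have mk: "- k \<in> \<Lambda>" "k \<in> \<Lambda>" "- k \<in> \<Lambda> - {0}" using k sym by auto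
  have zero: "(\<lambda>_. 0) \<in> sym_coeffs \<Lambda>" by (simp add: sym_coeffs_def)
  let ?F = "\<lambda>\<theta>. J_x (trig_val \<Lambda> p \<theta>) (trig_val \<Lambda> q \<theta>)"
  have F: "?F = (\<lambda>\<theta>. real \<nu> / (real \<nu> - 1) *
    ((trig_val \<Lambda> p \<theta> / trig_val \<Lambda> q \<theta>) ^ (\<nu> - 1) - lam / trig_val \<Lambda> p \<theta> ^ (\<nu> + 1)))"
    by (simp add: J_x_def \<alpha>_def \<beta>_def right_diff_distrib mult.commute)
  have int: "integrable torus_measure ?F"
    using integrable_J(2)[OF pos] .
  have "pair_coeffs k 0 = 0" using k by (auto simp: pair_coeffs_def)
  then have "(LINT \<theta>|torus_measure. trig_val \<Lambda> (pair_coeffs k) \<theta> * ?F \<theta>) = m k + m (- k)"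
    using stationarity[OF min pair_coeffs_sym[OF mk(2)] _ zero] sum_pair_coeffs[OF _ k mk(3), of m] fin
    by (simp add: linear_part_def trig_val_sum[of _ "\<lambda>_. 0"])
  then have "m k = Re (moment ?F k)"
    using integral_trig_val_mult(2)[OF int, of \<Lambda> "pair_coeffs k"] m
      sum_pair_coeffs[OF fin mk(2,1), of "\<lambda>j. Re (moment ?F j)"] Re_moment_uminus[OF int, of k]
    by simp
  moreover have "?F \<in> borel_measurable borel" by measurable
  ultimately show ?thesis
    using moment_real[of J_x p q k] int unfolding F[symmetric] by simp
qed

text \<open>Since P / Q is positive, the real power of (P / Q)^\<nu> is (P / Q)^(\<nu> - 1). The
  equation for m_k then splits into two moments once both summands are known to be
  integrable.\<close>

lemma cepstral_error:
  assumes min: "minimizer p q" and k: "k \<in> \<Lambda> - {0}" and m: "m (- k) = m k"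
  shows "of_real (real \<nu> / (real \<nu> - 1)) *
      moment (\<lambda>\<theta>. ((trig_val \<Lambda> p \<theta> / trig_val \<Lambda> q \<theta>) ^ \<nu>) powr ((real \<nu> - 1) / real \<nu>)) k - complex_of_real (m k) =
    of_real (lam * real \<nu> / (real \<nu> - 1)) * moment (\<lambda>\<theta>. 1 / trig_val \<Lambda> p \<theta> ^ (\<nu> + 1)) k"
proof -
  note pos = minimizer_P_pos[OF min] minimizer_Q_pos[OF min]
  let ?P = "trig_val \<Lambda> p" and ?Q = "trig_val \<Lambda> q"
  have "((?P \<theta> / ?Q \<theta>) ^ \<nu>) powr ((real \<nu> - 1) / real \<nu>) = (?P \<theta> / ?Q \<theta>) ^ (\<nu> - 1)" for \<theta>
  proof -
    have r: "0 < ?P \<theta> / ?Q \<theta>" using pos pos_polys_trig_val_pos by simp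
    have "((?P \<theta> / ?Q \<theta>) ^ \<nu>) powr ((real \<nu> - 1) / real \<nu>) =
        (?P \<theta> / ?Q \<theta>) powr (real \<nu> * ((real \<nu> - 1) / real \<nu>))"
      using r by (simp only: powr_realpow[symmetric] powr_powr)
    also have "real \<nu> * ((real \<nu> - 1) / real \<nu>) = real (\<nu> - 1)"
      using nu by (simp add: of_nat_diff)
    finally show ?thesis using r by (simp only: powr_realpow)
  qed
  note Phi = this
  have inv: "integrable torus_measure (\<lambda>\<theta>. 1 / ?P \<theta> ^ (\<nu> + 1))"
  proof -
    obtain \<delta> where \<delta>: "0 < \<delta>" "\<And>\<theta>. \<delta> \<le> ?P \<theta>"
      using trig_val_pos_bound[of \<Lambda> p] pos(1) unfolding pos_polys_def by blast
    have "norm (1 / ?P \<theta> ^ (\<nu> + 1)) \<le> 1 / \<delta> ^ (\<nu> + 1)" for \<theta>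
      using power_mono[OF \<delta>(2)[of \<theta>], of "\<nu> + 1"] \<delta>(1) less_le_trans[OF \<delta>]
      by (simp add: frac_le del: power_Suc)
    then show ?thesis
      by (intro integrable_torus_measure_bounded) (measurable, blast)
  qed
  have u: "integrable torus_measure (\<lambda>\<theta>. (?P \<theta> / ?Q \<theta>) ^ (\<nu> - 1))"
  proof -
    \<comment> \<open>Solving the formula for \<open>J_x\<close> for (P / Q)^(\<nu> - 1) expresses
      it by integrable functions.\<close>
    have "integrable torus_measure (\<lambda>\<theta>. (J_x (?P \<theta>) (?Q \<theta>) + \<beta> * real \<nu> * (1 / ?P \<theta> ^ (\<nu> + 1))) / (\<alpha> * real \<nu>))"
      by (intro integrable_divide_zero Bochner_Integration.integrable_add integrable_J(2) pos integrable_mult_right inv)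
    then show ?thesis using \<alpha>_pos nu by (simp add: J_x_def)
  qed
  have "complex_of_real (m k) = moment (\<lambda>\<theta>. real \<nu> / (real \<nu> - 1) *
      ((?P \<theta> / ?Q \<theta>) ^ (\<nu> - 1) - lam / ?P \<theta> ^ (\<nu> + 1))) k"
    by (rule minimizer_moments_m[OF min k m])
  also have "\<dots> = (LINT \<theta>|torus_measure. of_real (real \<nu> / (real \<nu> - 1)) *
        (exp (\<i> * of_real (pairing k \<theta>)) * of_real ((?P \<theta> / ?Q \<theta>) ^ (\<nu> - 1))) -
      of_real (lam * real \<nu> / (real \<nu> - 1)) * (exp (\<i> * of_real (pairing k \<theta>)) * of_real (1 / ?P \<theta> ^ (\<nu> + 1))))"
    unfolding moment_def by (intro Bochner_Integration.integral_cong refl) (simp add: algebra_simps)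
  also have "\<dots> = of_real (real \<nu> / (real \<nu> - 1)) * moment (\<lambda>\<theta>. (?P \<theta> / ?Q \<theta>) ^ (\<nu> - 1)) k -
      of_real (lam * real \<nu> / (real \<nu> - 1)) * moment (\<lambda>\<theta>. 1 / ?P \<theta> ^ (\<nu> + 1)) k"
    unfolding moment_def
    by (simp only: Bochner_Integration.integral_diff[OF
          integrable_mult_right[OF integrable_moment[OF u]] integrable_mult_right[OF integrable_moment[OF inv]]]
        integral_mult_right_zero)
  finally show ?thesis unfolding Phi by simp
qed

end

theorem theorem1:
  fixes \<nu> :: nat and lam :: real
    and \<Lambda> :: "(int ^ 'd) set"
    and c m :: "int ^ 'd \<Rightarrow> real"
  assumes "\<nu> \<ge> 2" and "lam > 0"
    and "finite \<Lambda>" and "0 \<in> \<Lambda>" and "uminus ` \<Lambda> = \<Lambda>"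
    and "\<forall>k\<in>\<Lambda>. c (- k) = c k"
    and "\<forall>k\<in>\<Lambda> - {0}. m (- k) = m k"
    and feasible: "\<exists>(\<Phi>\<^sub>0 :: real ^ 'd \<Rightarrow> real) x r.
          integrable torus_measure \<Phi>\<^sub>0 \<and> (\<forall>\<theta>\<in>torus. 0 \<le> \<Phi>\<^sub>0 \<theta>) \<and>
          0 < r \<and> ball x r \<subseteq> torus \<and> (\<forall>\<theta>\<in>ball x r. 0 < \<Phi>\<^sub>0 \<theta>) \<and>
          (\<forall>k\<in>\<Lambda>. complex_of_real (c k) = moment \<Phi>\<^sub>0 k)"
    and "real \<nu> \<ge> real CARD('d) / 2"
  shows "\<exists>p\<in>pos_polys_norm \<Lambda>. \<exists>q\<in>pos_polys \<Lambda>.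
    (let P = trig_val \<Lambda> p; Q = trig_val \<Lambda> q; \<Phi> = (\<lambda>\<theta>. (P \<theta> / Q \<theta>) ^ \<nu>);
         J = (\<lambda>(p, q). dual_fun \<nu> lam \<Lambda> c m p q);
         adm = (\<lambda>(p, q). p \<in> closure (pos_polys_norm \<Lambda>) \<and> q \<in> closure (pos_polys \<Lambda>))
     in is_arg_min J adm (p, q) \<and>
        (\<forall>z. is_arg_min J adm z \<longrightarrow> z = (p, q)) \<and>
        (\<forall>k\<in>\<Lambda>. complex_of_real (c k) = moment \<Phi> k) \<and>
        (\<forall>k\<in>\<Lambda> - {0}. complex_of_real (m k) =
           moment (\<lambda>\<theta>. real \<nu> / (real \<nu> - 1) *
             ((P \<theta> / Q \<theta>) ^ (\<nu> - 1) - lam / P \<theta> ^ (\<nu> + 1))) k) \<and>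
        (\<forall>k\<in>\<Lambda> - {0}.
           of_real (real \<nu> / (real \<nu> - 1)) *
             moment (\<lambda>\<theta>. \<Phi> \<theta> powr ((real \<nu> - 1) / real \<nu>)) k - complex_of_real (m k) =
           of_real (lam * real \<nu> / (real \<nu> - 1)) * moment (\<lambda>\<theta>. 1 / P \<theta> ^ (\<nu> + 1)) k))"
proof -
  obtain \<Phi>\<^sub>0 :: "real ^ 'd \<Rightarrow> real" and x r where \<Phi>:
    "integrable torus_measure \<Phi>\<^sub>0" "\<And>\<theta>. \<theta> \<in> torus \<Longrightarrow> 0 \<le> \<Phi>\<^sub>0 \<theta>"
    "0 < r" "ball x r \<subseteq> torus" "\<And>\<theta>. \<theta> \<in> ball x r \<Longrightarrow> 0 < \<Phi>\<^sub>0 \<theta>"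
    "\<And>k. k \<in> \<Lambda> \<Longrightarrow> complex_of_real (c k) = moment \<Phi>\<^sub>0 k"
    using feasible by metis
  interpret dual_problem \<nu> lam \<Lambda> c m
  proof
    show "0 < (\<Sum>k\<in>\<Lambda>. q k * c k)" if "q \<in> nonneg_polys \<Lambda>" "q \<noteq> (\<lambda>_. 0)" for q
      by (rule feasible_moments_positive[OF assms(3,5) \<Phi> that])
    show "CARD('d) \<le> 2 * \<nu>" using assms(9) by linarith
  qed (use assms in auto)
  have cl: "closure (pos_polys_norm \<Lambda>) = norm_polys" "closure (pos_polys \<Lambda>) = nonneg_polys \<Lambda>"
    using closure_pos_polys_norm[OF fin zero] closure_pos_polys[OF fin zero]
    by (auto simp: norm_polys_def nonneg_polys_def)
  \<comment> \<open>On the closed feasible set \<open>dual_fun\<close> equals \<open>dual\<close>,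
    and in a linear order a point that no other point beats is a least one.\<close>
  have argmin: "is_arg_min (\<lambda>(p, q). dual_fun \<nu> lam \<Lambda> c m p q)
      (\<lambda>(p, q). p \<in> norm_polys \<and> q \<in> nonneg_polys \<Lambda>) (p, q) \<longleftrightarrow> minimizer p q" for p q
    by (auto simp: is_arg_min_linorder minimizer_def dual_fun_eq_dual)
  obtain p q where min: "minimizer p q"
    using exists_minimizer unfolding minimizer_def by metis
  have q: "q \<in> pos_polys \<Lambda>" by (rule minimizer_Q_pos[OF min])
  have p: "p \<in> pos_polys_norm \<Lambda>"
    using minimizer_P_pos[OF min] min by (simp add: pos_polys_norm_def minimizer_def norm_polys_def)
  show ?thesis
    unfolding Let_def cl
  proof (intro bexI[OF _ p] bexI[OF _ q] conjI ballI allI impI)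
    let ?J = "\<lambda>(p, q). dual_fun \<nu> lam \<Lambda> c m p q"
    let ?adm = "\<lambda>(p, q). p \<in> norm_polys \<and> q \<in> nonneg_polys \<Lambda>"
    show "is_arg_min ?J ?adm (p, q)"
      using min by (simp only: argmin)
    show "z = (p, q)" if z: "is_arg_min ?J ?adm z" for z
    proof (cases z)
      case (Pair p' q')
      then have "minimizer p' q'" using z by (simp only: argmin)
      then show ?thesis using minimizer_unique[OF min] Pair by blast
    qed
  next
    fix k assume k: "k \<in> \<Lambda>"
    show "complex_of_real (c k) = moment (\<lambda>\<theta>. (trig_val \<Lambda> p \<theta> / trig_val \<Lambda> q \<theta>) ^ \<nu>) k"
      using minimizer_moments_c[OF min k] assms(6) k by blast
  next
    fix k assume k: "k \<in> \<Lambda> - {0}"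
    then have mk: "m (- k) = m k" using assms(7) by blast
    show "complex_of_real (m k) = moment (\<lambda>\<theta>. real \<nu> / (real \<nu> - 1) *
        ((trig_val \<Lambda> p \<theta> / trig_val \<Lambda> q \<theta>) ^ (\<nu> - 1) - lam / trig_val \<Lambda> p \<theta> ^ (\<nu> + 1))) k"
      by (rule minimizer_moments_m[OF min k mk])
    show "of_real (real \<nu> / (real \<nu> - 1)) *
        moment (\<lambda>\<theta>. ((trig_val \<Lambda> p \<theta> / trig_val \<Lambda> q \<theta>) ^ \<nu>) powr ((real \<nu> - 1) / real \<nu>)) k -
        complex_of_real (m k) =
      of_real (lam * real \<nu> / (real \<nu> - 1)) * moment (\<lambda>\<theta>. 1 / trig_val \<Lambda> p \<theta> ^ (\<nu> + 1)) k"
      by (rule cepstral_error[OF min k mk])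
  qed
qed

end
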